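(* Let $1\le s\le r\le n$ with $s<n$, and let $A=(a_{ij})\in\mathbb Z^{r\times s}$. Consider the polynomial in the variables $\mathbf x=(x_{ij})_{1\le i\le n-r,\,1\le j\le s}$ and $\mathbf y=(y_{ij})_{1\le i\le n,\,1\le j\le n-s}$ $$F(\mathbf x,\mathbf y)=\det\begin{pmatrix} a_{11}&\cdots&a_{1s}&y_{11}&\cdots&y_{1(n-s)}\\ \vdots&&\vdots&\vdots&&\vdots\\ a_{r1}&\cdots&a_{rs}&y_{r1}&\cdots&y_{r(n-s)}\\ x_{11}&\cdots&x_{1s}&y_{(r+1)1}&\cdots&y_{(r+1)(n-s)}\\ \vdots&&\vdots&\vdots&&\vdots\\ x_{(n-r)1}&\cdots&x_{(n-r)s}&y_{n1}&\cdots&y_{n(n-s)}\end{pmatrix}.$$ Then $F$ represents all integers (i.e. for every $b\in\mathbb Z$ there are integer $\mathbf x,\mathbf y$ with $F(\mathbf x,\mathbf y)=b$) if and only if one of the following holds: (i) $r+s\le n$; (ii) $r+s>n$ and the minors of order $r+s-n$ of $A$ are coprime (their greatest common divisor is $1$). Moreover, if (i) or (ii) holds, there is a finite algorithm that produces an integer solution of $F(\mathbf x,\mathbf y)=b$ for all $b\in\mathbb Z$ simultaneously. *)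

theory Defs
  imports
    "Jordan_Normal_Form.Determinant"
    "Jordan_Normal_Form.DL_Submatrix"
    "HOL-Computational_Algebra.Polynomial"
    "HOL-Library.Nat_Bijection"
begin

text \<open>
  Rows and columns are numbered from 0. For an \<open>r \<times> s\<close> matrix \<open>A\<close>, an \<open>(n - r) \<times> s\<close> matrix \<open>X\<close>
  and an \<open>n \<times> (n - s)\<close> matrix \<open>Y\<close>, the left block of the bordered matrix is \<open>A\<close> on top of \<open>X\<close>,
  and the right block is \<open>Y\<close>.
\<close>

definition bordered_mat :: "nat \<Rightarrow> 'a mat \<Rightarrow> 'a mat \<Rightarrow> 'a mat \<Rightarrow> 'a mat" where
  "bordered_mat n A X Y =
     (let r = dim_row A; s = dim_col A in
      mat n n (\<lambda>(i, j).
        if j < s then (if i < r then A $$ (i, j) else X $$ (i - r, j))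
        else Y $$ (i, j - s)))"

definition bordered_det :: "nat \<Rightarrow> int mat \<Rightarrow> int mat \<Rightarrow> int mat \<Rightarrow> int" where
  "bordered_det n A X Y = det (bordered_mat n A X Y)"

definition minors :: "nat \<Rightarrow> int mat \<Rightarrow> int set" where
  "minors k A = {det (submatrix A I J) | I J.
     I \<subseteq> {0..<dim_row A} \<and> J \<subseteq> {0..<dim_col A} \<and> card I = k \<and> card J = k}"

text \<open>
  Algorithms are programs for partial recursive functions on the natural numbers.
  \<open>recf_eval f xs y\<close> means that the program \<open>f\<close> halts on the argument list \<open>xs\<close> with result \<open>y\<close>.
  The recursion argument of \<open>PrimRec\<close> and the search argument of \<open>Mu\<close> come first.
\<close>

datatype recf =
    Zero
  | Succ
  | Proj nat
  | Comp recf "recf list"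
  | PrimRec recf recf
  | Mu recf

inductive recf_eval :: "recf \<Rightarrow> nat list \<Rightarrow> nat \<Rightarrow> bool" where
  zero: "recf_eval Zero xs 0"
| succ: "recf_eval Succ [x] (Suc x)"
| proj: "i < length xs \<Longrightarrow> recf_eval (Proj i) xs (xs ! i)"
| comp: "length ys = length gs \<Longrightarrow> (\<forall>i<length gs. recf_eval (gs ! i) xs (ys ! i)) \<Longrightarrow>
    recf_eval f ys z \<Longrightarrow> recf_eval (Comp f gs) xs z"
| primrec_0: "recf_eval f xs y \<Longrightarrow> recf_eval (PrimRec f g) (0 # xs) y"
| primrec_Suc: "recf_eval (PrimRec f g) (k # xs) u \<Longrightarrow> recf_eval g (k # u # xs) y \<Longrightarrow>
    recf_eval (PrimRec f g) (Suc k # xs) y"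
| mu: "recf_eval f (k # xs) 0 \<Longrightarrow> (\<forall>j<k. \<exists>v. 0 < v \<and> recf_eval f (j # xs) v) \<Longrightarrow>
    recf_eval (Mu f) xs k"

inductive_cases recf_eval_ZeroE: "recf_eval Zero xs y"
inductive_cases recf_eval_SuccE: "recf_eval Succ xs y"
inductive_cases recf_eval_ProjE: "recf_eval (Proj i) xs y"
inductive_cases recf_eval_CompE: "recf_eval (Comp f gs) xs y"
inductive_cases recf_eval_PrimRec_0E: "recf_eval (PrimRec f g) (0 # xs) y"
inductive_cases recf_eval_PrimRec_SucE: "recf_eval (PrimRec f g) (Suc k # xs) y"
inductive_cases recf_eval_MuE: "recf_eval (Mu f) xs y"

lemma recf_eval_deterministic:
  "recf_eval f xs y \<Longrightarrow> recf_eval f xs z \<Longrightarrow> y = z"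
proof (induction arbitrary: z rule: recf_eval.induct)
  case (zero xs)
  then show ?case by (rule recf_eval_ZeroE) simp
next
  case (succ x)
  then show ?case by (rule recf_eval_SuccE) simp
next
  case (proj i xs)
  from proj.prems show ?case by (rule recf_eval_ProjE) simp
next
  case (comp ys gs xs f y)
  from comp.prems show ?case
  proof (rule recf_eval_CompE)
    fix ys'
    assume ys': "length ys' = length gs" "\<forall>i<length gs. recf_eval (gs ! i) xs (ys' ! i)"
      "recf_eval f ys' z"
    have "ys ! i = ys' ! i" if "i < length gs" for i
      using comp.IH(1) ys'(2) that by blast
    then have "ys = ys'"
      using comp.hyps(1) ys'(1) by (intro nth_equalityI) simp_all
    with ys'(3) comp.IH(2) show "y = z" by blast
  qed
next
  case (primrec_0 f xs y g)
  from primrec_0.prems show ?case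
    by (rule recf_eval_PrimRec_0E) (rule primrec_0.IH)
next
  case (primrec_Suc f g k xs u y)
  from primrec_Suc.prems show ?case
  proof (rule recf_eval_PrimRec_SucE)
    fix u'
    assume u': "recf_eval (PrimRec f g) (k # xs) u'" "recf_eval g (k # u' # xs) z"
    from u'(1) have "u = u'" by (rule primrec_Suc.IH(1))
    with u'(2) show "y = z" using primrec_Suc.IH(2) by blast
  qed
next
  case (mu f k xs)
  from mu.prems show ?case
  proof (rule recf_eval_MuE)
    assume z: "recf_eval f (z # xs) 0" "\<forall>j<z. \<exists>v. 0 < v \<and> recf_eval f (j # xs) v"
    show "k = z"
    proof (rule linorder_cases[of k z])
      assume "k < z"
      then obtain v where "0 < v" "recf_eval f (k # xs) v" using z(2) by blast
      then show ?thesis using mu.IH(1) by blast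
    next
      assume "z < k"
      then obtain v where "0 < v" "\<forall>w. recf_eval f (z # xs) w \<longrightarrow> v = w"
        using mu.IH(2) by blast
      then show ?thesis using z(1) by blast
    qed
  qed
qed

definition mat_encode :: "('a \<Rightarrow> nat) \<Rightarrow> 'a mat \<Rightarrow> nat" where
  "mat_encode e M = list_encode (map (\<lambda>row. list_encode (map e row)) (mat_to_list M))"

definition poly_encode :: "int poly \<Rightarrow> nat" where
  "poly_encode p = list_encode (map int_encode (coeffs p))"

text \<open>
  A solution of \<open>bordered_det n A X Y = b\<close> for all \<open>b\<close> simultaneously is a pair of matrices over
  \<open>\<int>[t]\<close> whose specialisation at \<open>t = b\<close> is an integer solution for each integer \<open>b\<close>.
\<close>

definition parametric_solution :: "nat \<Rightarrow> int mat \<Rightarrow> int poly mat \<Rightarrow> int poly mat \<Rightarrow> bool" where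
  "parametric_solution n A X Y \<longleftrightarrow>
     X \<in> carrier_mat (n - dim_row A) (dim_col A) \<and> Y \<in> carrier_mat n (n - dim_col A) \<and>
     (\<forall>b. bordered_det n A (map_mat (\<lambda>p. poly p b) X) (map_mat (\<lambda>p. poly p b) Y) = b)"

end

theory Submission
  imports Defs
begin

text \<open>
  Put \<open>k = r + s - n\<close> and call an \<open>n \<times> n\<close> matrix with top left block \<open>A\<close> a completion of \<open>A\<close>. By
  Laplace expansion, an integer divides the determinants of all completions iff it divides all
  minors of \<open>A\<close> of order \<open>k\<close>. This gives necessity of the gcd condition, and shows that the condition
  is invariant under row and column operations on \<open>A\<close>. Among all matrices reachable from \<open>A\<close>, a
  nonzero entry of least absolute value divides all entries of its matrix, so it is a unit when
  \<open>k > 0\<close>. Splitting it off lowers \<open>n\<close>, \<open>r\<close>, \<open>s\<close> and \<open>k\<close> by one, until \<open>r + s \<le> n\<close>, where a product of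
  two unipotent block matrices is a completion.

  The completion obtained is a product of elementary matrices, so an unbounded search through all
  sequences of row operations finds one. Multiplying one column of its right block by the
  indeterminate gives the parametric solution.
\<close>

subsection \<open>Computable functions\<close>

text \<open>Only argument lists of length \<open>k\<close> matter, so functions may use
  \<open>!\<close>, \<open>hd\<close> and \<open>drop\<close> with no care for shorter
  lists.\<close>

definition computable :: "nat \<Rightarrow> (nat list \<Rightarrow> nat) \<Rightarrow> bool" where
  "computable k f \<longleftrightarrow> (\<exists>p. \<forall>xs. length xs = k \<longrightarrow> recf_eval p xs (f xs))"

lemma computable_cong:
  assumes "computable k f" "\<And>xs. length xs = k \<Longrightarrow> f xs = g xs"
  shows "computable k g"
  using assms unfolding computable_def by metis

lemma computable_comp:
  assumes "computable (length fs) g" and "\<forall>f\<in>set fs. computable k f"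
  shows "computable k (\<lambda>xs. g (map (\<lambda>f. f xs) fs))"
proof -
  obtain p where p: "\<And>xs. length xs = length fs \<Longrightarrow> recf_eval p xs (g xs)"
    using assms(1) unfolding computable_def by blast
  obtain P where P: "\<And>f xs. f \<in> set fs \<Longrightarrow> length xs = k \<Longrightarrow> recf_eval (P f) xs (f xs)"
    using assms(2) unfolding computable_def by metis
  have "recf_eval (Comp p (map P fs)) xs (g (map (\<lambda>f. f xs) fs))" if "length xs = k" for xs
    by (rule recf_eval.comp[where ys = "map (\<lambda>f. f xs) fs"]) (use that p P in simp_all)
  then show ?thesis unfolding computable_def by blast
qed

lemma computable_comp1:
  assumes "computable 1 (\<lambda>xs. g (xs ! 0))" "computable k a"
  shows "computable k (\<lambda>xs. g (a xs))"
  using computable_comp[of "[a]" "\<lambda>xs. g (xs ! 0)" k] assms by simp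

lemma computable_comp2:
  assumes "computable 2 (\<lambda>xs. g (xs ! 0) (xs ! 1))" "computable k a" "computable k b"
  shows "computable k (\<lambda>xs. g (a xs) (b xs))"
  using computable_comp[of "[a, b]" "\<lambda>xs. g (xs ! 0) (xs ! 1)" k] assms by (simp add: numeral_2_eq_2)

lemma computable_nth: "i < k \<Longrightarrow> computable k (\<lambda>xs. xs ! i)"
  unfolding computable_def using recf_eval.proj by blast

text \<open>Inside a bounded quantifier or a recursion the parameters stand behind one or two new
  arguments. This rule matches the terms such as \<open>drop 1 ys ! i\<close> that arise
  there.\<close>

lemma computable_drop_nth:
  assumes "d + i < k"
  shows "computable k (\<lambda>xs. drop d xs ! i)"
proof -
  have "recf_eval (Proj (d + i)) xs (drop d xs ! i)" if "length xs = k" for xs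
    using recf_eval.proj[of "d + i" xs] assms that by simp
  then show ?thesis unfolding computable_def by blast
qed

lemma computable_drop:
  assumes "computable k f"
  shows "computable (d + k) (\<lambda>ys. f (drop d ys))"
proof -
  have "\<forall>h\<in>set (map (\<lambda>i ys. ys ! (d + i)) [0..<k]). computable (d + k) h"
    by (auto intro: computable_nth)
  then have "computable (d + k) (\<lambda>ys. f (map (\<lambda>i. ys ! (d + i)) [0..<k]))"
    using computable_comp[of "map (\<lambda>i ys. ys ! (d + i)) [0..<k]" f "d + k"] assms
    by (simp add: comp_def)
  then show ?thesis
  proof (rule computable_cong)
    show "f (map (\<lambda>i. ys ! (d + i)) [0..<k]) = f (drop d ys)" if "length ys = d + k" for ys
      by (rule arg_cong[of _ _ f], rule nth_equalityI) (use that in auto)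
  qed
qed

text \<open>Weakening with substitution: a function of one bound variable and \<open>k\<close>
  parameters is reused where \<open>d\<close> arguments precede the parameters, with the computed
  value \<open>e\<close> in place of the bound variable.\<close>

lemma computable_subst:
  assumes "computable (Suc k) (\<lambda>ys. f (ys ! 0) (drop 1 ys))" "computable (d + k) e"
  shows "computable (d + k) (\<lambda>ys. f (e ys) (drop d ys))"
proof -
  have "\<forall>h\<in>set (e # map (\<lambda>i ys. ys ! (d + i)) [0..<k]). computable (d + k) h"
    using assms(2) by (auto intro: computable_nth)
  then have "computable (d + k) (\<lambda>ys. f (e ys) (map (\<lambda>i. ys ! (d + i)) [0..<k]))"
    using computable_comp[of "e # map (\<lambda>i ys. ys ! (d + i)) [0..<k]"
        "\<lambda>ys. f (ys ! 0) (drop 1 ys)" "d + k"] assms(1)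
    by (simp add: comp_def)
  then show ?thesis
  proof (rule computable_cong)
    show "f (e ys) (map (\<lambda>i. ys ! (d + i)) [0..<k]) = f (e ys) (drop d ys)"
      if "length ys = d + k" for ys
      by (rule arg_cong[of _ _ "f (e ys)"], rule nth_equalityI) (use that in auto)
  qed
qed

lemma computable_Suc:
  assumes "computable k f"
  shows "computable k (\<lambda>xs. Suc (f xs))"
proof (rule computable_comp1[OF _ assms])
  have "recf_eval Succ xs (Suc (xs ! 0))" if "length xs = 1" for xs
    using that recf_eval.succ by (cases xs) auto
  then show "computable 1 (\<lambda>xs. Suc (xs ! 0))" unfolding computable_def by blast
qed

lemma computable_const: "computable k (\<lambda>xs. c)"
proof (induction c)
  case 0
  then show ?case unfolding computable_def using recf_eval.zero by blast
qed (rule computable_Suc)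

text \<open>\<open>PrimRec\<close> computes the recursion with the counter as an additional first
  argument; composing with \<open>m\<close> and the projections sets that argument to
  \<open>m xs\<close>. The step function receives counter, accumulator and parameters in this
  order.\<close>

lemma computable_rec_nat:
  assumes "computable k f" "computable k m"
    and "computable (Suc (Suc k)) (\<lambda>ys. g (ys ! 0) (ys ! 1) (drop 2 ys))"
  shows "computable k (\<lambda>xs. rec_nat (f xs) (\<lambda>t u. g t u xs) (m xs))"
proof -
  obtain p where p: "\<And>xs. length xs = k \<Longrightarrow> recf_eval p xs (f xs)"
    using assms(1) unfolding computable_def by blast
  obtain q where q: "\<And>ys. length ys = Suc (Suc k) \<Longrightarrow> recf_eval q ys (g (ys ! 0) (ys ! 1) (drop 2 ys))"
    using assms(3) unfolding computable_def by blast
  have "recf_eval (PrimRec p q) (t # xs) (rec_nat (f xs) (\<lambda>t u. g t u xs) t)"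
    if "length xs = k" for t xs
  proof (induction t)
    case 0
    then show ?case using p that by (simp add: recf_eval.primrec_0)
  next
    case (Suc t)
    then show ?case using q[of "t # rec_nat (f xs) (\<lambda>t u. g t u xs) t # xs"] that
      by (auto intro: recf_eval.primrec_Suc)
  qed
  then have "computable (Suc k) (\<lambda>ys. rec_nat (f (tl ys)) (\<lambda>t u. g t u (tl ys)) (hd ys))"
    unfolding computable_def by (intro exI[of _ "PrimRec p q"]) (auto simp: length_Suc_conv)
  moreover have "\<forall>h\<in>set (m # map (\<lambda>i xs. xs ! i) [0..<k]). computable k h"
    using assms(2) by (auto intro: computable_nth)
  ultimately have "computable k (\<lambda>xs. rec_nat (f (map (\<lambda>i. xs ! i) [0..<k]))
      (\<lambda>t u. g t u (map (\<lambda>i. xs ! i) [0..<k])) (m xs))"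
    using computable_comp[of "m # map (\<lambda>i xs. xs ! i) [0..<k]"
        "\<lambda>ys. rec_nat (f (tl ys)) (\<lambda>t u. g t u (tl ys)) (hd ys)" k]
    by (simp add: comp_def)
  then show ?thesis by (rule computable_cong) (metis map_nth)
qed

section \<open>Arithmetic, decidable predicates and unbounded search\<close>

lemma computable_add:
  assumes "computable k f" "computable k g"
  shows "computable k (\<lambda>xs. f xs + g xs)"
proof -
  have *: "rec_nat a (\<lambda>t u. Suc u) b = a + b" for a b by (induction b) auto
  have "computable k (\<lambda>xs. rec_nat (f xs) (\<lambda>t u. Suc u) (g xs))"
    by (rule computable_rec_nat assms computable_Suc computable_nth)+ simp
  then show ?thesis by (simp add: *)
qed

lemma computable_mult:
  assumes "computable k f" "computable k g"
  shows "computable k (\<lambda>xs. f xs * g xs)"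
proof -
  have *: "rec_nat 0 (\<lambda>t u. u + a) b = a * b" for a b :: nat by (induction b) auto
  have "computable 2 (\<lambda>xs. rec_nat 0 (\<lambda>t u. u + xs ! 0) (xs ! 1))"
    by (rule computable_rec_nat computable_const computable_add computable_drop_nth computable_nth
        | simp)+
  then have "computable 2 (\<lambda>xs. xs ! 0 * xs ! 1)" by (simp add: *)
  then show ?thesis by (rule computable_comp2) fact+
qed

lemma computable_diff:
  assumes "computable k f" "computable k g"
  shows "computable k (\<lambda>xs. f xs - g xs)"
proof -
  \<comment> \<open>Predecessor: the step discards the accumulator and returns the counter, which
    ends one below the argument. Truncated subtraction iterates it.\<close>
  have "rec_nat 0 (\<lambda>t u. t) a = a - 1" for a by (induction a) auto
  moreover have "computable 1 (\<lambda>xs. rec_nat 0 (\<lambda>t u. t) (xs ! 0))"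
    by (rule computable_rec_nat computable_const computable_nth | simp)+
  ultimately have "computable 1 (\<lambda>xs. xs ! 0 - 1)" by simp
  note pred = computable_comp1[OF this]
  have *: "rec_nat a (\<lambda>t u. u - 1) b = a - b" for a b :: nat by (induction b) auto
  have "computable k (\<lambda>xs. rec_nat (f xs) (\<lambda>t u. u - 1) (g xs))"
    by (rule computable_rec_nat assms pred computable_nth)+ simp
  then show ?thesis by (simp only: *)
qed

lemma computable_of_bool_le:
  assumes "computable k f" "computable k g"
  shows "computable k (\<lambda>xs. of_bool (f xs \<le> g xs))"
proof -
  have *: "of_bool (a \<le> b) = 1 - (a - b)" for a b :: nat by auto
  show ?thesis unfolding * by (intro computable_diff computable_const assms)
qed

lemma computable_of_bool_not:
  assumes "computable k (\<lambda>xs. of_bool (P xs))"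
  shows "computable k (\<lambda>xs. of_bool (\<not> P xs))"
proof -
  have *: "of_bool (\<not> b) = 1 - (of_bool b :: nat)" for b by auto
  show ?thesis unfolding * by (intro computable_diff computable_const assms)
qed

lemma computable_of_bool_conj:
  assumes "computable k (\<lambda>xs. of_bool (P xs))" "computable k (\<lambda>xs. of_bool (Q xs))"
  shows "computable k (\<lambda>xs. of_bool (P xs \<and> Q xs))"
proof -
  have *: "of_bool (a \<and> b) = of_bool a * (of_bool b :: nat)" for a b by auto
  show ?thesis unfolding * by (intro computable_mult assms)
qed

lemma computable_of_bool_less:
  assumes "computable k f" "computable k g"
  shows "computable k (\<lambda>xs. of_bool (f xs < g xs))"
  unfolding not_le[symmetric] by (intro computable_of_bool_not computable_of_bool_le assms)

lemma computable_of_bool_eq: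
  assumes "computable k f" "computable k g"
  shows "computable k (\<lambda>xs. of_bool (f xs = (g xs :: nat)))"
  unfolding order_eq_iff by (intro computable_of_bool_conj computable_of_bool_le assms)

lemma computable_if:
  assumes "computable k (\<lambda>xs. of_bool (P xs))" "computable k f" "computable k g"
  shows "computable k (\<lambda>xs. if P xs then f xs else g xs)"
proof -
  have *: "(if b then x else y) = of_bool b * x + (1 - of_bool b) * y" for b and x y :: nat
    by auto
  show ?thesis unfolding *
    by (intro computable_add computable_mult computable_diff computable_const assms)
qed

lemma computable_of_bool_ball:
  assumes "computable k m" "computable (Suc k) (\<lambda>ys. of_bool (P (ys ! 0) (drop 1 ys)))"
  shows "computable k (\<lambda>xs. of_bool (\<forall>i<m xs. P i xs))"
proof -
  \<comment> \<open>A bounded universal quantifier is the product of the truth values.\<close>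
  have *: "rec_nat 1 (\<lambda>t u. u * of_bool (P t xs)) b = (of_bool (\<forall>i<b. P i xs) :: nat)" for b xs
    by (induction b) (auto simp: less_Suc_eq)
  have P: "computable (Suc (Suc k)) (\<lambda>ys. of_bool (P (ys ! 0) (drop 2 ys)))"
    using computable_subst[OF assms(2), of 2 "\<lambda>ys. ys ! 0"] computable_nth[of 0] by simp
  have "computable k (\<lambda>xs. rec_nat 1 (\<lambda>t u. u * of_bool (P t xs)) (m xs))"
    by (rule computable_rec_nat computable_const computable_mult computable_nth assms(1) P | simp)+
  then show ?thesis by (simp only: *)
qed

text \<open>\<open>Mu\<close> stops at a zero, so it is applied to the truth value of the negation.
  Nothing is claimed for arguments without a witness; the main algorithm is partial in this
  way.\<close>

lemma computable_search:
  assumes "computable (Suc k) (\<lambda>ys. of_bool (P (ys ! 0) (drop 1 ys)))"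
  shows "\<exists>p. \<forall>xs. length xs = k \<and> (\<exists>z. P z xs) \<longrightarrow> recf_eval p xs (LEAST z. P z xs)"
proof -
  obtain p where p: "\<And>ys. length ys = Suc k \<Longrightarrow> recf_eval p ys (of_bool (\<not> P (ys ! 0) (drop 1 ys)))"
    using computable_of_bool_not[OF assms] unfolding computable_def by blast
  have "recf_eval (Mu p) xs (LEAST z. P z xs)" if "length xs = k" "\<exists>z. P z xs" for xs
  proof (rule recf_eval.mu)
    show "recf_eval p ((LEAST z. P z xs) # xs) 0"
      using p[of "(LEAST z. P z xs) # xs"] that LeastI_ex[OF that(2)] by simp
    show "\<forall>j<LEAST z. P z xs. \<exists>v>0. recf_eval p (j # xs) v"
    proof (intro allI impI)
      fix j assume "j < (LEAST z. P z xs)"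
      then have "\<not> P j xs" by (rule not_less_Least)
      then show "\<exists>v>0. recf_eval p (j # xs) v"
        using p[of "j # xs"] that by (intro exI[of _ 1]) simp
    qed
  qed
  then show ?thesis by blast
qed

lemma computable_Least:
  assumes "\<And>xs. length xs = k \<Longrightarrow> \<exists>z. P z xs"
    and "computable (Suc k) (\<lambda>ys. of_bool (P (ys ! 0) (drop 1 ys)))"
  shows "computable k (\<lambda>xs. LEAST z. P z xs)"
  using computable_search[OF assms(2)] assms(1) unfolding computable_def by blast

lemmas computable_basic = computable_nth computable_drop_nth computable_const computable_Suc
  computable_add computable_mult computable_diff computable_of_bool_le computable_of_bool_less
  computable_of_bool_eq computable_of_bool_not computable_of_bool_conj computable_if
  computable_of_bool_ball computable_rec_nat

lemma computable_div2:
  assumes "computable k f"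
  shows "computable k (\<lambda>xs. f xs div 2)"
proof -
  have *: "c div 2 = (LEAST h. c < 2 * Suc h)" for c :: nat
    by (rule sym, rule Least_equality) auto
  have "computable 1 (\<lambda>xs. LEAST h. xs ! 0 < 2 * Suc h)"
  proof (rule computable_Least)
    show "\<exists>z. xs ! 0 < 2 * Suc z" for xs :: "nat list" by (rule exI[of _ "xs ! 0"]) simp
    show "computable (Suc 1) (\<lambda>ys. of_bool (drop 1 ys ! 0 < 2 * Suc (ys ! 0)))"
      by (intro computable_basic) auto
  qed
  then have "computable 1 (\<lambda>xs. xs ! 0 div 2)" by (simp only: *)
  then show ?thesis by (rule computable_comp1) fact
qed

section \<open>Arithmetic on coded integers\<close>

lemma int_encode_diff:
  "int_encode (int a - int b) = (if b \<le> a then 2 * (a - b) else 2 * (b - a) - 1)"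
proof -
  have "nat (int b - (int a + 1)) = b - Suc a" by simp
  then show ?thesis by (auto simp: int_encode_def sum_encode_def nat_diff_distrib)
qed

text \<open>\<open>int_encode\<close> sends \<open>m\<close> to \<open>2 * m\<close> and
  \<open>- m - 1\<close> to \<open>2 * m + 1\<close> for natural \<open>m\<close>, so the parity of
  a code gives the sign.\<close>

lemma nat_conv_int_encode:
  "nat i = (if 2 * (int_encode i div 2) = int_encode i then int_encode i div 2 else 0)"
  "nat (- i) = (if 2 * (int_encode i div 2) = int_encode i then 0 else Suc (int_encode i div 2))"
  by (auto simp: int_encode_def sum_encode_def)

lemma computable_int_encode_diff:
  assumes "computable k f" "computable k g"
  shows "computable k (\<lambda>xs. int_encode (int (f xs) - int (g xs)))"
  unfolding int_encode_diff by (intro computable_basic assms)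

lemma computable_nat_of_int:
  assumes "computable k (\<lambda>xs. int_encode (f xs))"
  shows "computable k (\<lambda>xs. nat (f xs))" "computable k (\<lambda>xs. nat (- f xs))"
  \<comment> \<open>The first equation also matches \<open>nat (- f xs)\<close>, so the second one
    has to be applied before it.\<close>
  unfolding nat_conv_int_encode(2) unfolding nat_conv_int_encode(1)
  by (intro computable_basic computable_div2 assms)+

text \<open>Integers are split into positive and negative parts, so that the result is a difference
  of two natural numbers computed by natural arithmetic.\<close>

lemma computable_int_add:
  assumes "computable k (\<lambda>xs. int_encode (f xs))" "computable k (\<lambda>xs. int_encode (g xs))"
  shows "computable k (\<lambda>xs. int_encode (f xs + g xs))"
proof -
  have *: "i + j = int (nat i + nat j) - int (nat (- i) + nat (- j))" for i j by simp
  show ?thesis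
    unfolding *[of "f _"] by (intro computable_int_encode_diff computable_basic computable_nat_of_int assms)
qed

lemma computable_int_mult:
  assumes "computable k (\<lambda>xs. int_encode (f xs))" "computable k (\<lambda>xs. int_encode (g xs))"
  shows "computable k (\<lambda>xs. int_encode (f xs * g xs))"
proof -
  have *: "i * j = int (nat i * nat j + nat (- i) * nat (- j)) -
    int (nat i * nat (- j) + nat (- i) * nat j)" for i j
    by (cases "0 \<le> i"; cases "0 \<le> j") auto
  show ?thesis
    unfolding *[of "f _"] by (intro computable_int_encode_diff computable_basic computable_nat_of_int assms)
qed

lemma computable_int_if:
  assumes "computable k (\<lambda>xs. of_bool (P xs))"
    "computable k (\<lambda>xs. int_encode (f xs))" "computable k (\<lambda>xs. int_encode (g xs))"
  shows "computable k (\<lambda>xs. int_encode (if P xs then f xs else g xs))"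
  unfolding if_distrib[of int_encode] by (intro computable_if assms)

lemma computable_int_decode:
  assumes "computable k f"
  shows "computable k (\<lambda>xs. int_encode (int_decode (f xs)))"
  using assms by simp

section \<open>Coded pairs and lists\<close>

lemma computable_triangle:
  assumes "computable k f"
  shows "computable k (\<lambda>xs. triangle (f xs))"
proof -
  have *: "triangle m = rec_nat 0 (\<lambda>t u. u + Suc t) m" for m by (induction m) auto
  show ?thesis unfolding * by (intro computable_basic assms) auto
qed

lemma computable_prod_encode:
  assumes "computable k f" "computable k g"
  shows "computable k (\<lambda>xs. prod_encode (f xs, g xs))"
  unfolding prod_encode_def prod.case by (intro computable_basic computable_triangle assms)

lemma triangle_mono: "mono triangle"
  by (rule mono_iff_le_Suc[THEN iffD2]) simp

text \<open>\<open>prod_encode (m, n)\<close> is \<open>triangle (m + n) + m\<close>, which is less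
  than the next triangular number. So a search for the first triangular number above a code recovers
  \<open>m + n\<close>, and from it both components.\<close>

lemma Least_triangle_prod_encode: "(LEAST w. prod_encode (m, n) < triangle (Suc w)) = m + n"
proof (rule Least_equality)
  show "m + n \<le> w" if "prod_encode (m, n) < triangle (Suc w)" for w
    using that monoD[OF triangle_mono, of "Suc w" "m + n"]
    by (force simp: prod_encode_def simp del: triangle_Suc)
qed (simp add: prod_encode_def)

lemma computable_prod_decode:
  assumes "computable k f"
  shows "computable k (\<lambda>xs. fst (prod_decode (f xs)))" "computable k (\<lambda>xs. snd (prod_decode (f xs)))"
proof -
  let ?w = "\<lambda>c. LEAST w. c < triangle (Suc w)"
  have "?w c = fst (prod_decode c) + snd (prod_decode c)" for c
    using Least_triangle_prod_encode[of "fst (prod_decode c)" "snd (prod_decode c)"] by simp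
  moreover have "triangle (fst (prod_decode c) + snd (prod_decode c)) + fst (prod_decode c) = c" for c
    using prod_decode_inverse[of c] unfolding prod_encode_def by (simp add: case_prod_beta)
  ultimately have *: "fst (prod_decode c) = c - triangle (?w c)"
    "snd (prod_decode c) = ?w c - fst (prod_decode c)" for c
    by (simp_all, metis add_diff_cancel_left')
  have "computable 1 (\<lambda>xs. ?w (xs ! 0))"
  proof (rule computable_Least)
    show "\<exists>w. xs ! 0 < triangle (Suc w)" for xs :: "nat list"
      by (rule exI[of _ "xs ! 0"]) simp
    show "computable (Suc 1) (\<lambda>ys. of_bool (drop 1 ys ! 0 < triangle (Suc (ys ! 0))))"
      by (intro computable_basic computable_triangle) auto
  qed
  note w = computable_comp1[OF this assms]
  show fst: "computable k (\<lambda>xs. fst (prod_decode (f xs)))"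
    unfolding * by (intro computable_basic computable_triangle assms w)
  show "computable k (\<lambda>xs. snd (prod_decode (f xs)))"
    unfolding *(2) by (intro computable_basic w fst)
qed

text \<open>A nonempty list is coded as the successor of the pair of its head and the code of its
  tail, so \<open>snd (prod_decode (u - 1))\<close> codes the tail. The code 0 of the empty list is
  mapped to itself, since \<open>0 - 1 = 0\<close> decodes to \<open>(0, 0)\<close>.\<close>

definition code_nth :: "nat \<Rightarrow> nat \<Rightarrow> nat" where
  "code_nth c i = fst (prod_decode (rec_nat c (\<lambda>t u. snd (prod_decode (u - 1))) i - 1))"

lemma code_nth_list_encode:
  assumes "i < length xs"
  shows "code_nth (list_encode xs) i = xs ! i"
proof -
  have zero: "prod_decode 0 = (0, 0)"
    by (simp add: prod_decode_def prod_decode_aux.simps)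
  have "snd (prod_decode (list_encode ys - 1)) = list_encode (tl ys)" for ys
    by (cases ys) (simp_all add: zero)
  then have "rec_nat (list_encode xs) (\<lambda>t u. snd (prod_decode (u - 1))) i = list_encode (drop i xs)"
    by (induction i) (simp_all add: drop_Suc tl_drop)
  then show ?thesis using Cons_nth_drop_Suc[OF assms, symmetric] by (simp add: code_nth_def)
qed

lemma computable_code_nth:
  assumes "computable k f" "computable k g"
  shows "computable k (\<lambda>xs. code_nth (f xs) (g xs))"
  unfolding code_nth_def by (intro computable_basic computable_prod_decode assms) auto

lemma computable_list_encode_map:
  assumes "computable k m" "computable (Suc k) (\<lambda>ys. f (ys ! 0) (drop 1 ys))"
  shows "computable k (\<lambda>xs. list_encode (map (\<lambda>i. f i xs) [0..<m xs]))"
proof -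
  \<comment> \<open>New entries can only be put in front, so the list is built from its end: after
    \<open>t\<close> steps the accumulator codes the last \<open>t\<close> entries.\<close>
  have *: "rec_nat 0 (\<lambda>t u. Suc (prod_encode (f (b - Suc t) xs, u))) t =
      list_encode (map (\<lambda>i. f i xs) [b - t..<b])" if "t \<le> b" for t b xs
    using that
  proof (induction t)
    case (Suc t)
    then have "[b - Suc t..<b] = (b - Suc t) # [b - t..<b]" by (simp add: upt_rec Suc_diff_Suc)
    then show ?case using Suc by simp
  qed simp
  have m: "computable (Suc (Suc k)) (\<lambda>ys. m (drop 2 ys))"
    using computable_drop[OF assms(1), of 2] by simp
  have "computable (2 + k) (\<lambda>ys. m (drop 2 ys) - Suc (ys ! 0))"
    using m by (intro computable_basic) auto
  from computable_subst[OF assms(2) this]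
  have f: "computable (Suc (Suc k)) (\<lambda>ys. f (m (drop 2 ys) - Suc (ys ! 0)) (drop 2 ys))" by simp
  have "computable k (\<lambda>xs. rec_nat 0 (\<lambda>t u. Suc (prod_encode (f (m xs - Suc t) xs, u))) (m xs))"
    by (intro computable_rec_nat computable_const assms computable_Suc computable_prod_encode f
        computable_nth) auto
  then show ?thesis by (simp add: *)
qed

subsection \<open>Search for a completion\<close>

text \<open>Swaps and scalings are excluded. All members then have determinant 1, and a search
  through them never has to compute a determinant.\<close>

inductive_set elementary :: "nat \<Rightarrow> int mat set" for n where
  one: "1\<^sub>m n \<in> elementary n"
| addrow: "M \<in> elementary n \<Longrightarrow> i < n \<Longrightarrow> j < n \<Longrightarrow> i \<noteq> j \<Longrightarrow> addrow c i j M \<in> elementary n"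

lemma elementary_carrier: "M \<in> elementary n \<Longrightarrow> M \<in> carrier_mat n n"
  by (induction rule: elementary.induct) auto

lemma det_elementary: "M \<in> elementary n \<Longrightarrow> det M = 1"
proof (induction rule: elementary.induct)
  case (addrow M i j c)
  then show ?case using det_addrow[of j n i M c] elementary_carrier by simp
qed simp

definition code_entry :: "nat \<Rightarrow> nat \<Rightarrow> nat \<Rightarrow> nat" where
  "code_entry w i j = code_nth (code_nth w i) j"

definition code_mat :: "nat \<Rightarrow> nat \<Rightarrow> (nat \<Rightarrow> nat \<Rightarrow> nat) \<Rightarrow> nat" where
  "code_mat m n F = list_encode (map (\<lambda>i. list_encode (map (\<lambda>j. F i j) [0..<n])) [0..<m])"

lemma mat_encode_eq: "mat_encode e M = code_mat (dim_row M) (dim_col M) (\<lambda>i j. e (M $$ (i, j)))"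
  by (simp add: mat_encode_def code_mat_def mat_to_list_def comp_def)

lemma code_entry_code_mat: "i < m \<Longrightarrow> j < n \<Longrightarrow> code_entry (code_mat m n F) i j = F i j"
  by (simp add: code_entry_def code_mat_def code_nth_list_encode)

lemma code_entry_mat_encode:
  "i < dim_row M \<Longrightarrow> j < dim_col M \<Longrightarrow> code_entry (mat_encode e M) i j = e (M $$ (i, j))"
  by (simp add: mat_encode_eq code_entry_code_mat)

lemma code_mat_cong:
  "(\<And>i j. i < m \<Longrightarrow> j < n \<Longrightarrow> F i j = G i j) \<Longrightarrow> code_mat m n F = code_mat m n G"
  unfolding code_mat_def by (intro arg_cong[of _ _ list_encode] map_cong refl) auto

text \<open>Row numbers satisfy \<open>a < n\<close>, so a triple with \<open>i \<ge> n\<close>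
  changes no row; the other invalid triples fail the test
  \<open>i \<noteq> j \<and> j < n\<close>.\<close>

definition apply_op :: "nat \<Rightarrow> nat \<Rightarrow> nat \<Rightarrow> nat \<Rightarrow> nat \<Rightarrow> nat" where
  "apply_op n w i j c = code_mat n n (\<lambda>a b. int_encode
     (if a = i \<and> i \<noteq> j \<and> j < n
      then int_decode c * int_decode (code_entry w j b) + int_decode (code_entry w a b)
      else int_decode (code_entry w a b)))"

lemma apply_op_mat_encode:
  assumes "M \<in> carrier_mat n n"
  shows "apply_op n (mat_encode int_encode M) i j c = mat_encode int_encode
    (if i < n \<and> j < n \<and> i \<noteq> j then addrow (int_decode c) i j M else M)"
proof -
  have "apply_op n (mat_encode int_encode M) i j c = code_mat n n (\<lambda>a b. int_encode
    ((if i < n \<and> j < n \<and> i \<noteq> j then addrow (int_decode c) i j M else M) $$ (a, b)))"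
    unfolding apply_op_def
    by (rule code_mat_cong) (use assms in \<open>auto simp: code_entry_mat_encode\<close>)
  then show ?thesis using assms by (simp add: mat_encode_eq)
qed

text \<open>The number \<open>z\<close> codes the length of a list of operations and the list. Every operation is a coded
  triple \<open>(i, j, c)\<close>, and \<open>apply_op\<close> skips the triples that are not valid operations.\<close>

definition run_ops :: "nat \<Rightarrow> nat \<Rightarrow> nat" where
  "run_ops n z = rec_nat (code_mat n n (\<lambda>i j. int_encode (if i = j then 1 else 0)))
     (\<lambda>t w. apply_op n w (fst (prod_decode (code_nth (snd (prod_decode z)) t)))
       (fst (prod_decode (snd (prod_decode (code_nth (snd (prod_decode z)) t)))))
       (snd (prod_decode (snd (prod_decode (code_nth (snd (prod_decode z)) t))))))
     (fst (prod_decode z))"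

lemma run_ops_0: "run_ops n (prod_encode (0, l)) = mat_encode int_encode (1\<^sub>m n)"
  by (auto simp: run_ops_def mat_encode_eq intro: code_mat_cong)

lemma run_ops_Suc:
  "run_ops n (prod_encode (Suc t, l)) = apply_op n (run_ops n (prod_encode (t, l)))
    (fst (prod_decode (code_nth l t))) (fst (prod_decode (snd (prod_decode (code_nth l t)))))
    (snd (prod_decode (snd (prod_decode (code_nth l t)))))"
  by (simp add: run_ops_def)

text \<open>Every number decodes to a sequence of operations with the invalid ones skipped, so
  whatever a search over \<open>z\<close> returns is elementary.\<close>

lemma run_ops_sound: "\<exists>M\<in>elementary n. run_ops n z = mat_encode int_encode M"
proof -
  have "\<exists>M\<in>elementary n. run_ops n (prod_encode (t, l)) = mat_encode int_encode M" for t l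
  proof (induction t)
    case 0
    then show ?case using run_ops_0 elementary.one by blast
  next
    case (Suc t)
    then obtain M where M: "M \<in> elementary n" "run_ops n (prod_encode (t, l)) = mat_encode int_encode M"
      by blast
    show ?case
      unfolding run_ops_Suc M(2) apply_op_mat_encode[OF elementary_carrier[OF M(1)]]
      by (rule bexI, rule refl) (use M(1) in \<open>auto intro: elementary.addrow\<close>)
  qed
  from this[of "fst (prod_decode z)" "snd (prod_decode z)"] show ?thesis by simp
qed

lemma run_ops_complete:
  assumes "M \<in> elementary n"
  shows "\<exists>z. run_ops n z = mat_encode int_encode M"
proof -
  \<comment> \<open>The first \<open>t\<close> operations depend only on the first \<open>t\<close>
    list entries, so appending an operation leaves the earlier run unchanged.\<close>
  have mono: "run_ops n (prod_encode (t, list_encode (os @ os'))) = run_ops n (prod_encode (t, list_encode os))"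
    if "t \<le> length os" for t os os'
    using that by (induction t) (simp_all add: run_ops_0 run_ops_Suc code_nth_list_encode nth_append)
  have "\<exists>os. run_ops n (prod_encode (length os, list_encode os)) = mat_encode int_encode M"
    using assms
  proof (induction rule: elementary.induct)
    case one
    show ?case by (rule exI[of _ "[]"]) (simp only: run_ops_0 list.size)
  next
    case (addrow M i j c)
    then obtain os where os: "run_ops n (prod_encode (length os, list_encode os)) = mat_encode int_encode M"
      by blast
    let ?o = "prod_encode (i, prod_encode (j, int_encode c))"
    have "run_ops n (prod_encode (length (os @ [?o]), list_encode (os @ [?o]))) =
        mat_encode int_encode (addrow c i j M)"
      using addrow.hyps elementary_carrier[OF addrow.hyps(1)]
      by (simp add: run_ops_Suc mono os code_nth_list_encode apply_op_mat_encode)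
    then show ?case by blast
  qed
  then show ?thesis by blast
qed

lemma computable_code_entry:
  assumes "computable k w" "computable k i" "computable k j"
  shows "computable k (\<lambda>xs. code_entry (w xs) (i xs) (j xs))"
  unfolding code_entry_def by (intro computable_code_nth assms)

text \<open>The inner list adds its counter in front of that of the outer list. Hence the row index
  is \<open>ys ! 1\<close> and the column index is \<open>ys ! 0\<close>.\<close>

lemma computable_code_mat:
  assumes "computable k m" "computable k n"
    and "computable (Suc (Suc k)) (\<lambda>ys. F (ys ! 1) (ys ! 0) (drop 2 ys))"
  shows "computable k (\<lambda>xs. code_mat (m xs) (n xs) (\<lambda>i j. F i j xs))"
proof -
  have F: "computable (Suc (Suc k)) (\<lambda>ys. F (drop 1 ys ! 0) (ys ! 0) (drop 1 (drop 1 ys)))"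
    using assms(3) by (rule computable_cong) (simp add: numeral_2_eq_2)
  have n: "computable (Suc k) (\<lambda>ys. n (drop 1 ys))"
    using computable_drop[OF assms(2), of 1] by simp
  show ?thesis
    unfolding code_mat_def using computable_list_encode_map[OF assms(1)
      computable_list_encode_map[where f = "\<lambda>j ys. F (ys ! 0) j (drop 1 ys)", OF n F]] .
qed

lemmas computable_intros = computable_basic computable_prod_encode computable_prod_decode
  computable_int_add computable_int_mult computable_int_if computable_int_decode
  computable_code_nth computable_code_entry computable_code_mat

lemma computable_run_ops:
  assumes "computable k n" "computable k z"
  shows "computable k (\<lambda>xs. run_ops (n xs) (z xs))"
proof -
  \<comment> \<open>Shown once for five variables; arbitrary computable arguments follow by
    composition.\<close>
  have "computable 5 (\<lambda>xs. apply_op (xs ! 0) (xs ! 1) (xs ! 2) (xs ! 3) (xs ! 4))"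
    unfolding apply_op_def by (intro computable_intros) simp_all
  then have apply_op: "computable k (\<lambda>xs. apply_op (n xs) (w xs) (i xs) (j xs) (c xs))"
    if "computable k n" "computable k w" "computable k i" "computable k j" "computable k c"
    for k n w i j c
    using computable_comp[of "[n, w, i, j, c]"
        "\<lambda>xs. apply_op (xs ! 0) (xs ! 1) (xs ! 2) (xs ! 3) (xs ! 4)" k] that
    by (simp add: eval_nat_numeral)
  have "computable 2 (\<lambda>xs. run_ops (xs ! 0) (xs ! 1))"
    unfolding run_ops_def by (intro computable_intros apply_op) simp_all
  then show ?thesis by (rule computable_comp2) fact+
qed

section \<open>From a completion to a parametric solution\<close>

definition const_code :: "nat \<Rightarrow> nat" where
  "const_code c = (if c = 0 then 0 else Suc (prod_encode (c, 0)))"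

definition linear_code :: "nat \<Rightarrow> nat" where
  "linear_code c = (if c = 0 then 0 else Suc (prod_encode (0, Suc (prod_encode (c, 0)))))"

lemma int_encode_0: "int_encode i = 0 \<longleftrightarrow> i = 0"
  by (auto simp: int_encode_def sum_encode_def)

text \<open>The zero polynomial has the empty coefficient list and the integer 0 has code 0, which
  accounts for the case \<open>c = 0\<close> of both polynomial codes.\<close>

lemma poly_encode_const: "poly_encode [:i:] = const_code (int_encode i)"
  by (auto simp: poly_encode_def const_code_def int_encode_0)

lemma poly_encode_linear: "poly_encode [:0, i:] = linear_code (int_encode i)"
  by (auto simp: poly_encode_def linear_code_def int_encode_0)

text \<open>Expansion along column \<open>k\<close>, whose cofactors do not involve the scaled
  entries.\<close>

lemma det_multcol:
  assumes M: "(M :: 'a :: comm_ring_1 mat) \<in> carrier_mat n n" and k: "k < n"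
  shows "det (multcol k c M) = c * det M"
proof -
  have "det (multcol k c M) = (\<Sum>i<n. multcol k c M $$ (i, k) * cofactor (multcol k c M) i k)"
    by (rule laplace_expansion_column) (use assms in auto)
  also have "\<dots> = (\<Sum>i<n. c * (M $$ (i, k) * cofactor M i k))"
  proof (rule sum.cong)
    fix i assume "i \<in> {..<n}"
    moreover have "mat_delete (multcol k c M) i k = mat_delete M i k"
      using M by (intro eq_matI) (auto simp: mat_delete_def)
    ultimately show "multcol k c M $$ (i, k) * cofactor (multcol k c M) i k =
        c * (M $$ (i, k) * cofactor M i k)"
      using M k by (simp add: cofactor_def mult.assoc)
  qed simp
  also have "\<dots> = c * det M"
    using laplace_expansion_column[OF M k] by (simp add: sum_distrib_left)
  finally show ?thesis .
qed

definition lower_block :: "nat \<Rightarrow> nat \<Rightarrow> nat \<Rightarrow> int mat \<Rightarrow> int poly mat" where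
  "lower_block n r s M = mat (n - r) s (\<lambda>(i, j). [:M $$ (r + i, j):])"

definition right_block :: "nat \<Rightarrow> nat \<Rightarrow> int mat \<Rightarrow> int poly mat" where
  "right_block n s M = mat n (n - s) (\<lambda>(i, j). if j = 0 then [:0, M $$ (i, s):] else [:M $$ (i, s + j):])"

text \<open>Evaluation at \<open>b\<close> multiplies column \<open>s\<close> of \<open>M\<close>,
  the first one outside \<open>A\<close>, by \<open>b\<close>. The determinant changes from 1 to
  \<open>b\<close>.\<close>

lemma parametric_solution_blocks:
  assumes "r \<le> n" "s < n" and A: "A \<in> carrier_mat r s" and M: "M \<in> carrier_mat n n" "det M = 1"
    and block: "\<And>i j. i < r \<Longrightarrow> j < s \<Longrightarrow> M $$ (i, j) = A $$ (i, j)"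
  shows "parametric_solution n A (lower_block n r s M) (right_block n s M)"
proof -
  have "bordered_mat n A (map_mat (\<lambda>p. poly p b) (lower_block n r s M))
      (map_mat (\<lambda>p. poly p b) (right_block n s M)) = multcol s b M" for b
    using assms
    by (intro eq_matI) (auto simp: bordered_mat_def lower_block_def right_block_def Let_def)
  then show ?thesis
    using assms det_multcol[OF M(1) \<open>s < n\<close>]
    by (simp add: parametric_solution_def bordered_det_def lower_block_def right_block_def)
qed

lemma exists_algorithm:
  "\<exists>alg. \<forall>n r s. \<forall>A \<in> carrier_mat r s. r \<le> n \<and> s < n \<and>
     (\<exists>M\<in>elementary n. \<forall>i<r. \<forall>j<s. M $$ (i, j) = A $$ (i, j)) \<longrightarrow>
     (\<exists>X Y. recf_eval alg [n, r, s, mat_encode int_encode A]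
        (prod_encode (mat_encode poly_encode X, mat_encode poly_encode Y)) \<and>
      parametric_solution n A X Y)"
proof -
  \<comment> \<open>The input \<open>xs\<close> is \<open>n\<close>, \<open>r\<close>,
    \<open>s\<close> and the code of \<open>A\<close>; the predicate says that the matrix coded by
    \<open>z\<close> agrees with \<open>A\<close> on the block.\<close>
  define P where "P z xs \<longleftrightarrow> (\<forall>i<xs ! 1. \<forall>j<xs ! 2.
    code_entry (run_ops (xs ! 0) z) i j = code_entry (xs ! 3) i j)" for z and xs :: "nat list"
  have "computable (Suc 4) (\<lambda>ys. of_bool (P (ys ! 0) (drop 1 ys)))"
    unfolding P_def drop_drop by ((intro computable_intros computable_run_ops | simp only: drop_drop)+)
  then obtain search where search: "\<And>xs. length xs = 4 \<Longrightarrow> \<exists>z. P z xs \<Longrightarrow>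
      recf_eval search xs (LEAST z. P z xs)"
    using computable_search[of 4 P] by blast
  define out where "out n r s w = prod_encode
    (code_mat (n - r) s (\<lambda>i j. const_code (code_entry w (r + i) j)),
     code_mat n (n - s) (\<lambda>i j. if j = 0 then linear_code (code_entry w i s)
       else const_code (code_entry w i (s + j))))" for n r s w
  \<comment> \<open>Here \<open>ys\<close> is the number found by the search followed by the four
    inputs, so \<open>n\<close>, \<open>r\<close>, \<open>s\<close> have the indices 1 to 3.\<close>
  have "computable 5 (\<lambda>ys. out (ys ! 1) (ys ! 2) (ys ! 3) (run_ops (ys ! 1) (ys ! 0)))"
    unfolding out_def const_code_def linear_code_def
    by (intro computable_intros computable_run_ops) simp_all
  then obtain outp where outp: "\<And>ys. length ys = 5 \<Longrightarrow>
      recf_eval outp ys (out (ys ! 1) (ys ! 2) (ys ! 3) (run_ops (ys ! 1) (ys ! 0)))"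
    unfolding computable_def by blast
  show ?thesis
  proof (intro exI[of _ "Comp outp (search # map Proj [0..<4])"] allI ballI impI)
    fix n r s and A :: "int mat"
    assume A: "A \<in> carrier_mat r s"
      and *: "r \<le> n \<and> s < n \<and> (\<exists>M\<in>elementary n. \<forall>i<r. \<forall>j<s. M $$ (i, j) = A $$ (i, j))"
    define xs where "xs = [n, r, s, mat_encode int_encode A]"
    \<comment> \<open>By injectivity of \<open>int_encode\<close>, comparing codes is comparing
      entries.\<close>
    have P_iff: "P z xs \<longleftrightarrow> (\<forall>i<r. \<forall>j<s. M $$ (i, j) = A $$ (i, j))"
      if "M \<in> elementary n" "run_ops n z = mat_encode int_encode M" for z M
      using that A * elementary_carrier[OF that(1)]
      by (auto simp: P_def xs_def code_entry_mat_encode int_encode_eq)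
    have ex: "\<exists>z. P z xs" using * run_ops_complete P_iff by blast
    define z where "z = (LEAST z. P z xs)"
    have "P z xs" unfolding z_def using ex by (rule LeastI_ex)
    obtain M where M: "M \<in> elementary n" "run_ops n z = mat_encode int_encode M" using run_ops_sound by blast
    have block: "\<forall>i<r. \<forall>j<s. M $$ (i, j) = A $$ (i, j)" using P_iff[OF M] \<open>P z xs\<close> by blast
    note carrier = elementary_carrier[OF M(1)]
    have "recf_eval search xs z" unfolding z_def using search ex by (simp add: xs_def)
    moreover have "recf_eval outp (z # xs) (out n r s (run_ops n z))"
      using outp[of "z # xs"] by (simp add: xs_def)
    moreover have "recf_eval ((search # map Proj [0..<4]) ! i) xs ((z # xs) ! i)"
      if "recf_eval search xs z" "i < 5" for i
      using that recf_eval.proj[of "i - 1" xs] by (cases i) (auto simp: xs_def)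
    ultimately have "recf_eval (Comp outp (search # map Proj [0..<4])) xs (out n r s (run_ops n z))"
      by (intro recf_eval.comp[where ys = "z # xs"]) (auto simp: xs_def)
    moreover have "out n r s (run_ops n z) = prod_encode
      (mat_encode poly_encode (lower_block n r s M), mat_encode poly_encode (right_block n s M))"
      unfolding out_def M(2) mat_encode_eq[of poly_encode] lower_block_def right_block_def dim_row_mat dim_col_mat
      by (rule arg_cong[of _ _ prod_encode], rule arg_cong2[of _ _ _ _ Pair]; rule code_mat_cong)
        (use * carrier in \<open>auto simp: code_entry_mat_encode poly_encode_const poly_encode_linear\<close>)
    ultimately show "\<exists>X Y. recf_eval (Comp outp (search # map Proj [0..<4]))
        [n, r, s, mat_encode int_encode A]
        (prod_encode (mat_encode poly_encode X, mat_encode poly_encode Y)) \<and> parametric_solution n A X Y"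
      using parametric_solution_blocks[OF _ _ A carrier det_elementary[OF M(1)]] block *
      unfolding xs_def by metis
  qed
qed

subsection \<open>Minors and completions\<close>

text \<open>The block is a function of two indices, so that transposing it, deleting a row or
  cutting off a corner is a mere substitution of indices.\<close>

definition has_block :: "nat \<Rightarrow> nat \<Rightarrow> (nat \<Rightarrow> nat \<Rightarrow> 'a) \<Rightarrow> 'a mat \<Rightarrow> bool" where
  "has_block r s a M \<longleftrightarrow> (\<forall>i<r. \<forall>j<s. M $$ (i, j) = a i j)"

definition completions_dvd :: "int \<Rightarrow> nat \<Rightarrow> nat \<Rightarrow> nat \<Rightarrow> (nat \<Rightarrow> nat \<Rightarrow> int) \<Rightarrow> bool" where
  "completions_dvd d n r s a \<longleftrightarrow> (\<forall>M\<in>carrier_mat n n. has_block r s a M \<longrightarrow> d dvd det M)"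

lemma completions_dvdD:
  "completions_dvd d n r s a \<Longrightarrow> M \<in> carrier_mat n n \<Longrightarrow> has_block r s a M \<Longrightarrow> d dvd det M"
  by (simp add: completions_dvd_def)

definition completable :: "nat \<Rightarrow> nat \<Rightarrow> nat \<Rightarrow> (nat \<Rightarrow> nat \<Rightarrow> int) \<Rightarrow> bool" where
  "completable n r s a \<longleftrightarrow> (\<exists>M\<in>elementary n. has_block r s a M)"

definition minor :: "nat \<Rightarrow> (nat \<Rightarrow> nat \<Rightarrow> 'a :: comm_ring_1) \<Rightarrow> (nat \<Rightarrow> nat) \<Rightarrow> (nat \<Rightarrow> nat) \<Rightarrow> 'a" where
  "minor k a f g = det (mat k k (\<lambda>(i, j). a (f i) (g j)))"

lemma minor_transpose: "minor k (\<lambda>i j. a j i) g f = minor k a f g"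
proof -
  have "mat k k (\<lambda>(i, j). a (f j) (g i)) = transpose_mat (mat k k (\<lambda>(i, j). a (f i) (g j)))"
    by (rule eq_matI) auto
  then show ?thesis unfolding minor_def using det_transpose[of "mat k k (\<lambda>(i, j). a (f i) (g j))" k] by simp
qed

lemma minor_cong:
  "(\<And>i j. i < k \<Longrightarrow> j < k \<Longrightarrow> a (f i) (g j) = b (f' i) (g' j)) \<Longrightarrow> minor k a f g = minor k b f' g'"
  unfolding minor_def by (rule arg_cong[of _ _ det], rule eq_matI) auto

text \<open>Laplace expansion along column \<open>j\<close>; \<open>insert_index i\<close>
  enumerates the indices other than \<open>i\<close>.\<close>

lemma dvd_minor_column:
  assumes "j < Suc t"
    and "\<And>i. i < Suc t \<Longrightarrow> d dvd a (f i) (g j) * minor t a (f \<circ> insert_index i) (g \<circ> insert_index j)"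
  shows "d dvd minor (Suc t) a f g"
proof -
  let ?A = "mat (Suc t) (Suc t) (\<lambda>(i, j). a (f i) (g j))"
  have "mat_delete ?A i j = mat t t (\<lambda>(i', j'). a ((f \<circ> insert_index i) i') ((g \<circ> insert_index j) j'))" for i
    by (rule eq_matI) (auto simp: mat_delete_def insert_index_def)
  then have "cofactor ?A i j = (-1) ^ (i + j) * minor t a (f \<circ> insert_index i) (g \<circ> insert_index j)" for i
    by (simp add: cofactor_def minor_def)
  then have "?A $$ (i, j) * cofactor ?A i j = (-1) ^ (i + j) *
      (a (f i) (g j) * minor t a (f \<circ> insert_index i) (g \<circ> insert_index j))" if "i < Suc t" for i
    using assms(1) that by (simp add: ac_simps)
  then have "d dvd ?A $$ (i, j) * cofactor ?A i j" if "i < Suc t" for i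
    using assms(2) that by simp
  then have "d dvd (\<Sum>i<Suc t. ?A $$ (i, j) * cofactor ?A i j)"
    by (intro dvd_sum) auto
  then show ?thesis
    unfolding minor_def using laplace_expansion_column[of ?A "Suc t" j] assms(1) by simp
qed

lemma strict_mono_insert_index:
  assumes "strict_mono_on {..<Suc t} f" "i < Suc t"
  shows "strict_mono_on {..<t} (f \<circ> insert_index i)"
  using assms by (auto simp: strict_mono_on_def insert_index_def)

lemma strict_mono_on_gap:
  fixes f :: "nat \<Rightarrow> nat"
  assumes "strict_mono_on {..<n} f" "i \<le> j" "j < n"
  shows "f i + (j - i) \<le> f j"
  using assms(2,3)
proof (induction j rule: dec_induct)
  case (step j)
  then have "f j < f (Suc j)" using assms(1) by (auto simp: strict_mono_on_def)
  then show ?case using step by simp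
qed simp

text \<open>Values grow by at least 1 per step. Counting from 0 gives \<open>i \<le> f i\<close>,
  counting down from \<open>n - 1\<close> gives \<open>f i \<le> i\<close>.\<close>

lemma strict_mono_on_lessThan_id:
  fixes f :: "nat \<Rightarrow> nat"
  assumes "strict_mono_on {..<n} f" "f ` {..<n} \<subseteq> {..<n}" "i < n"
  shows "f i = i"
proof (rule antisym)
  have "f (n - 1) < n" using assms by (auto simp: image_subset_iff)
  moreover have "f i + (n - 1 - i) \<le> f (n - 1)"
    by (rule strict_mono_on_gap[OF assms(1)]) (use assms(3) in auto)
  ultimately show "f i \<le> i" using assms(3) by linarith
  show "i \<le> f i" using strict_mono_on_gap[OF assms(1), of 0 i] assms(3) by simp
qed

definition minors_dvd :: "int \<Rightarrow> nat \<Rightarrow> nat \<Rightarrow> nat \<Rightarrow> (nat \<Rightarrow> nat \<Rightarrow> int) \<Rightarrow> bool" where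
  "minors_dvd d k r s a \<longleftrightarrow> (\<forall>f g. strict_mono_on {..<k} f \<and> strict_mono_on {..<k} g \<and>
     f ` {..<k} \<subseteq> {..<r} \<and> g ` {..<k} \<subseteq> {..<s} \<longrightarrow> d dvd minor k a f g)"

lemma minors_dvd_transpose:
  assumes "minors_dvd d k r s a"
  shows "minors_dvd d k s r (\<lambda>i j. a j i)"
  unfolding minors_dvd_def
proof (intro allI impI)
  fix g f assume "strict_mono_on {..<k} g \<and> strict_mono_on {..<k} f \<and>
    g ` {..<k} \<subseteq> {..<s} \<and> f ` {..<k} \<subseteq> {..<r}"
  then have "d dvd minor k a f g" using assms by (simp add: minors_dvd_def)
  then show "d dvd minor k (\<lambda>i j. a j i) g f" unfolding minor_transpose[of k a g f] .
qed

text \<open>A column outside the block is deleted together with some row, and the block is declared to lose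
  one row even if the deleted row misses it. So \<open>k\<close> stays the same throughout the induction.\<close>

lemma dvd_minor_if_minors_dvd:
  assumes "minors_dvd d k r s a"
    and "strict_mono_on {..<t} f" "strict_mono_on {..<t} g"
    and "p \<le> t" "q \<le> t" "p + q = t + k" "f ` {..<p} \<subseteq> {..<r}" "g ` {..<q} \<subseteq> {..<s}"
  shows "d dvd minor t a f g"
  using assms
proof (induction t arbitrary: f g p q r s a)
  case 0
  then show ?case by (auto simp: minors_dvd_def)
next
  case (Suc t)
  have column: "d dvd minor (Suc t) a f g"
    if "minors_dvd d k r s a" "strict_mono_on {..<Suc t} f" "strict_mono_on {..<Suc t} g"
      "p \<le> Suc t" "q \<le> t" "p + q = Suc t + k" "f ` {..<p} \<subseteq> {..<r}" "g ` {..<q} \<subseteq> {..<s}"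
    for f g p q r s and a :: "nat \<Rightarrow> nat \<Rightarrow> int"
  proof (rule dvd_minor_column[of t])
    fix i assume i: "i < Suc t"
    have "d dvd minor t a (f \<circ> insert_index i) (g \<circ> insert_index t)"
    \<comment> \<open>\<open>insert_index i\<close> raises an index by at most 1, so the first
      \<open>p - 1\<close> remaining rows come from the first \<open>p\<close> rows.\<close>
    proof (rule Suc.IH[OF that(1), where p = "p - 1" and q = q])
      show "strict_mono_on {..<t} (f \<circ> insert_index i)" "strict_mono_on {..<t} (g \<circ> insert_index t)"
        using that i by (auto intro: strict_mono_insert_index)
      show "(f \<circ> insert_index i) ` {..<p - 1} \<subseteq> {..<r}" using that(7)
        by (auto simp: insert_index_def image_subset_iff)
      show "(g \<circ> insert_index t) ` {..<q} \<subseteq> {..<s}" using that(5,8)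
        by (auto simp: insert_index_def image_subset_iff)
    qed (use that in auto)
    then show "d dvd a (f i) (g t) * minor t a (f \<circ> insert_index i) (g \<circ> insert_index t)" by simp
  qed simp
  consider "q \<le> t" | "p \<le> t" | "p = Suc t" "q = Suc t" using Suc.prems by linarith
  then show ?case
  proof cases
    case 1
    then show ?thesis using column Suc.prems by blast
  next
    case 2
    then have "d dvd minor (Suc t) (\<lambda>i j. a j i) g f"
      using column[OF minors_dvd_transpose[OF Suc.prems(1)], of g f q p] Suc.prems by simp
    then show ?thesis unfolding minor_transpose[of "Suc t" a g f] .
  next
    \<comment> \<open>Now \<open>k = Suc t\<close>, and the minor is itself one of those in the
      hypothesis.\<close>
    case 3
    then show ?thesis using Suc.prems by (auto simp: minors_dvd_def)
  qed
qed

lemma minors_dvd_cong: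
  assumes "\<And>i j. i < r \<Longrightarrow> j < s \<Longrightarrow> a i j = b i j"
  shows "minors_dvd d k r s a = minors_dvd d k r s b"
proof -
  have "minor k a f g = minor k b f g" if "f ` {..<k} \<subseteq> {..<r}" "g ` {..<k} \<subseteq> {..<s}" for f g
    by (rule minor_cong) (use that assms in auto)
  then show ?thesis unfolding minors_dvd_def by metis
qed

lemma completions_dvd_if_minors_dvd:
  assumes "r \<le> n" "s \<le> n" "r + s = n + k" "minors_dvd d k r s a"
  shows "completions_dvd d n r s a"
  unfolding completions_dvd_def
proof (intro ballI impI)
  fix M assume M: "M \<in> carrier_mat n n" "has_block r s a M"
  then have "minors_dvd d k r s (\<lambda>i j. M $$ (i, j))"
    using assms(4) minors_dvd_cong[of r s "\<lambda>i j. M $$ (i, j)" a] by (simp add: has_block_def)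
  \<comment> \<open>The whole matrix is its own minor of order \<open>n\<close>, with the block in
    its first \<open>r\<close> rows and \<open>s\<close> columns.\<close>
  then have "d dvd minor n (\<lambda>i j. M $$ (i, j)) (\<lambda>i. i) (\<lambda>j. j)"
    by (rule dvd_minor_if_minors_dvd[where p = r and q = s]) (use assms in \<open>auto simp: strict_mono_on_def\<close>)
  moreover have "mat n n (\<lambda>(i, j). M $$ (i, j)) = M" using M by auto
  ultimately show "d dvd det M" by (simp add: minor_def)
qed

lemma completions_dvd_transpose:
  assumes "completions_dvd d n r s a" "r \<le> n" "s \<le> n"
  shows "completions_dvd d n s r (\<lambda>i j. a j i)"
  unfolding completions_dvd_def
proof (intro ballI impI)
  fix M assume M: "M \<in> carrier_mat n n" "has_block s r (\<lambda>i j. a j i) M"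
  then have "has_block r s a (transpose_mat M)" using assms by (auto simp: has_block_def)
  then show "d dvd det M" using assms M det_transpose[OF M(1)] by (auto simp: completions_dvd_def)
qed

text \<open>A completion \<open>M'\<close> of the shorter block becomes one of the full block by
  inserting row \<open>i0\<close> and a last column whose only nonzero entry is a 1 in that row. The
  last column avoids the block because \<open>s \<le> m\<close>, and expanding along it gives the
  determinant of \<open>M'\<close> up to sign.\<close>

lemma completions_dvd_delete_row:
  assumes "completions_dvd d (Suc m) r s a" "r \<le> Suc m" "s \<le> m" "i0 < r"
  shows "completions_dvd d m (r - 1) s (\<lambda>i. a (insert_index i0 i))"
  unfolding completions_dvd_def
proof (intro ballI impI)
  fix M' assume M': "M' \<in> carrier_mat m m" "has_block (r - 1) s (\<lambda>i. a (insert_index i0 i)) M'"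
  define M where "M = mat (Suc m) (Suc m) (\<lambda>(x, y).
    if y = m then (if x = i0 then 1 else 0)
    else if x = i0 then a i0 y else M' $$ (delete_index i0 x, y))"
  have M: "M \<in> carrier_mat (Suc m) (Suc m)" by (simp add: M_def)
  have "M $$ (x, y) = a x y" if "x < r" "y < s" for x y
  proof (cases "x = i0")
    case False
    then have "delete_index i0 x < r - 1" using that assms by (auto simp: delete_index_def)
    then show ?thesis
      using that False M' assms by (simp add: M_def has_block_def insert_delete_index)
  qed (use that assms in \<open>simp add: M_def\<close>)
  then have "d dvd det M" using assms(1) M by (auto simp: completions_dvd_def has_block_def)
  moreover have "mat_delete M i0 m = M'"
    using M' assms by (intro eq_matI) (auto simp: mat_delete_def M_def delete_index_def)
  moreover have "det M = cofactor M i0 m"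
  proof -
    have "det M = (\<Sum>i<Suc m. M $$ (i, m) * cofactor M i m)"
      by (rule laplace_expansion_column[OF M]) simp
    also have "\<dots> = (\<Sum>i<Suc m. if i = i0 then cofactor M i m else 0)"
      by (rule sum.cong) (auto simp: M_def)
    also have "\<dots> = cofactor M i0 m" using assms by (simp del: sum.lessThan_Suc)
    finally show ?thesis .
  qed
  ultimately have "d dvd (-1) ^ (i0 + m) * det M'" by (simp add: cofactor_def)
  then show "d dvd det M'" by (cases "even (i0 + m)") simp_all
qed

text \<open>Rows and columns missed by a given minor are deleted one at a time, columns via
  transposition. At \<open>r = s = n\<close> the block is its own completion and the only minor is
  its determinant.\<close>

lemma completions_dvd_imp_minors_dvd:
  assumes "r \<le> n" "s \<le> n" "r + s = n + k" "completions_dvd d n r s a"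
  shows "minors_dvd d k r s a"
  using assms
proof (induction n arbitrary: r s a)
  case 0
  \<comment> \<open>The empty matrix is a completion with determinant 1, so \<open>d\<close> is a
    unit.\<close>
  have "d dvd det (1\<^sub>m 0 :: int mat)"
    by (rule completions_dvdD[OF 0(4)]) (use 0 in \<open>auto simp: has_block_def\<close>)
  then show ?case by (simp add: minors_dvd_def unit_imp_dvd)
next
  case (Suc m)
  have delete_row: "minors_dvd d k r s a"
    if "r \<le> Suc m" "s \<le> m" "r + s = Suc m + k" "completions_dvd d (Suc m) r s a" for r s a
    unfolding minors_dvd_def
  proof (intro allI impI, elim conjE)
    fix f g assume fg: "strict_mono_on {..<k} f" "strict_mono_on {..<k} g"
      "f ` {..<k} \<subseteq> {..<r}" "g ` {..<k} \<subseteq> {..<s}"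
    \<comment> \<open>From \<open>s \<le> m\<close> follows \<open>k < r\<close>, so
      \<open>f\<close> misses a row of the block.\<close>
    have "card (f ` {..<k}) < card {..<r}"
      using that card_image_le[of "{..<k}" f] by auto
    then have "\<not> {..<r} \<subseteq> f ` {..<k}"
      using card_mono[of "f ` {..<k}" "{..<r}"] by auto
    then obtain i0 where i0: "i0 < r" "i0 \<notin> f ` {..<k}" by blast
    have "minors_dvd d k (r - 1) s (\<lambda>i. a (insert_index i0 i))"
      by (rule Suc.IH) (use that completions_dvd_delete_row[OF that(4,1,2) i0(1)] in auto)
    moreover have "strict_mono_on {..<k} (delete_index i0 \<circ> f)"
      unfolding strict_mono_on_def
    proof (intro allI impI, elim conjE)
      fix x y assume xy: "x \<in> {..<k}" "y \<in> {..<k}" "x < y"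
      then have "f x < f y" using fg(1) by (auto simp: strict_mono_on_def)
      moreover have "f x \<noteq> i0" "f y \<noteq> i0" using xy i0 by auto
      ultimately show "(delete_index i0 \<circ> f) x < (delete_index i0 \<circ> f) y"
        by (auto simp: delete_index_def)
    qed
    moreover have "(delete_index i0 \<circ> f) ` {..<k} \<subseteq> {..<r - 1}"
    proof safe
      fix x assume "x < k"
      then have "f x < r" "f x \<noteq> i0" using fg i0 by auto
      then show "(delete_index i0 \<circ> f) x < r - 1" using i0 by (auto simp: delete_index_def)
    qed
    ultimately have "d dvd minor k (\<lambda>i. a (insert_index i0 i)) (delete_index i0 \<circ> f) g"
      using fg by (auto simp: minors_dvd_def)
    also have "minor k (\<lambda>i. a (insert_index i0 i)) (delete_index i0 \<circ> f) g = minor k a f g"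
    proof (rule minor_cong)
      fix i j assume "i < k"
      then have "f i \<noteq> i0" using i0 by auto
      then show "a (insert_index i0 ((delete_index i0 \<circ> f) i)) (g j) = a (f i) (g j)"
        by (simp add: insert_delete_index)
    qed
    finally show "d dvd minor k a f g" .
  qed
  consider "s \<le> m" | "r \<le> m" | "r = Suc m" "s = Suc m" using Suc.prems by linarith
  then show ?case
  proof cases
    case 1
    then show ?thesis using delete_row Suc.prems by blast
  next
    case 2
    have "minors_dvd d k s r (\<lambda>i j. a j i)"
      using delete_row[of s r "\<lambda>i j. a j i"] completions_dvd_transpose[OF Suc.prems(4,1,2)] 2 Suc.prems by simp
    from minors_dvd_transpose[OF this] show ?thesis .
  next
    case 3
    then have k: "k = Suc m" using Suc.prems by simp
    show ?thesis
      unfolding minors_dvd_def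
    proof (intro allI impI, elim conjE)
      fix f g assume fg: "strict_mono_on {..<k} f" "strict_mono_on {..<k} g"
        "f ` {..<k} \<subseteq> {..<r}" "g ` {..<k} \<subseteq> {..<s}"
      have "minor k a f g = minor k a (\<lambda>i. i) (\<lambda>j. j)"
        by (rule minor_cong) (use fg 3 k strict_mono_on_lessThan_id in metis)
      moreover have "d dvd minor k a (\<lambda>i. i) (\<lambda>j. j)"
        unfolding minor_def using Suc.prems(4) 3 k
        by (auto simp: has_block_def intro!: completions_dvdD[of d "Suc m" r s a])
      ultimately show "d dvd minor k a f g" by simp
    qed
  qed
qed

subsection \<open>Reduction to the corner\<close>

text \<open>A row addition is a left multiplication, so it can be moved out of the product.\<close>

lemma elementary_mult:
  assumes "M \<in> elementary n" "N \<in> elementary n"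
  shows "M * N \<in> elementary n"
  using assms(1)
proof (induction rule: elementary.induct)
  case one
  show ?case using elementary_carrier[OF assms(2)] assms(2) by simp
next
  case (addrow M i j c)
  note M = elementary_carrier[OF addrow.hyps(1)] and N = elementary_carrier[OF assms(2)]
  have "addrow c i j M * N = addrow_mat n c i j * M * N"
    using addrow_mat[OF M \<open>j < n\<close>] by simp
  also have "\<dots> = addrow_mat n c i j * (M * N)"
    by (rule assoc_mult_mat) (use M N in auto)
  also have "\<dots> = addrow c i j (M * N)"
    using addrow_mat[of "M * N" n n j c i] M N \<open>j < n\<close> by simp
  finally show ?case using addrow by (simp add: elementary.addrow)
qed

text \<open>A column addition is a right multiplication by a row addition matrix with the two
  indices exchanged.\<close>

lemma addcol_elementary:
  assumes "M \<in> elementary n" "i < n" "j < n" "i \<noteq> j"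
  shows "addcol c i j M \<in> elementary n"
proof -
  have "addrow_mat n c j i = addrow c j i (1\<^sub>m n)"
    using addrow_mat[of "1\<^sub>m n" n n i c j] assms by simp
  then have "addrow_mat n c j i \<in> elementary n" using assms by (simp add: elementary.one elementary.addrow)
  then show ?thesis
    using addcol_mat[OF elementary_carrier[OF assms(1)], of j c i] assms by (simp add: elementary_mult)
qed

definition transvection :: "nat \<Rightarrow> (nat \<times> nat) set \<Rightarrow> (nat \<Rightarrow> nat \<Rightarrow> int) \<Rightarrow> int mat" where
  "transvection n S N = mat n n (\<lambda>(i, j). (if i = j then 1 else 0) + (if (i, j) \<in> S then N i j else 0))"

text \<open>As \<open>P\<close> and \<open>Q\<close> are disjoint, the rows in \<open>Q\<close>
  remain unit vectors, so each pair \<open>(p, q)\<close> is filled in by one row addition that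
  changes a single entry.\<close>

lemma transvection_elementary:
  assumes "P \<inter> Q = {}" "P \<subseteq> {..<n}" "Q \<subseteq> {..<n}"
  shows "transvection n (P \<times> Q) N \<in> elementary n"
proof -
  have "finite (P \<times> Q)" using assms by (auto intro: finite_subset)
  moreover have "transvection n S N \<in> elementary n" if "finite S" "S \<subseteq> P \<times> Q" for S
    using that
  proof (induction S rule: finite_induct)
    case empty
    have "transvection n {} N = 1\<^sub>m n" by (rule eq_matI) (auto simp: transvection_def)
    then show ?case by (simp add: elementary.one)
  next
    case (insert x S)
    obtain p q where x: "x = (p, q)" by force
    then have pq: "p < n" "q < n" "p \<noteq> q" "\<And>j. (q, j) \<notin> S" using insert assms by auto
    have "transvection n (insert x S) N = addrow (N p q) p q (transvection n S N)"
      by (rule eq_matI) (use pq x insert.hyps in \<open>auto simp: transvection_def\<close>)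
    then show ?case using insert pq by (simp add: elementary.addrow)
  qed
  ultimately show ?thesis by blast
qed

lemma completable_if_le:
  assumes "r + s \<le> n" "s \<le> r" "s < n"
  shows "completable n r s a"
proof -
  \<comment> \<open>The first \<open>s\<close> columns of \<open>L\<close> carry an identity on top
    and another in the last \<open>s\<close> rows. Columns \<open>j\<close> and
    \<open>n - s + j\<close> of \<open>U\<close> are thus added; the correction by 1 in
    \<open>U\<close> cancels its diagonal. Both index pairs are disjoint since
    \<open>s \<le> r \<le> n - s\<close>.\<close>
  define L where "L = transvection n ({n - s..<n} \<times> {..<s}) (\<lambda>i j. if i = n - s + j then 1 else 0)"
  define U where "U = transvection n ({..<r} \<times> {n - s..<n})
    (\<lambda>i q. a i (q - (n - s)) - (if i = q - (n - s) then 1 else 0))"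
  have "U * L \<in> elementary n"
    unfolding U_def L_def by (intro elementary_mult transvection_elementary) (use assms in auto)
  moreover have "has_block r s a (U * L)"
    unfolding has_block_def
  proof (intro allI impI)
    fix i j assume ij: "i < r" "j < s"
    have "(U * L) $$ (i, j) = (\<Sum>q = 0..<n. U $$ (i, q) * L $$ (q, j))"
      using ij assms by (simp add: U_def L_def transvection_def scalar_prod_def)
    also have "\<dots> = (\<Sum>q = 0..<n. (if q = j then U $$ (i, q) else 0) + (if q = n - s + j then U $$ (i, q) else 0))"
      by (rule sum.cong) (use ij assms in \<open>auto simp: L_def transvection_def\<close>)
    also have "\<dots> = U $$ (i, j) + U $$ (i, n - s + j)"
      using ij assms by (simp add: sum.distrib)
    also have "\<dots> = a i j" using ij assms by (auto simp: U_def transvection_def)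
    finally show "(U * L) $$ (i, j) = a i j" .
  qed
  ultimately show ?thesis unfolding completable_def by blast
qed

section \<open>Row and column operations on the block\<close>

definition rowop :: "int \<Rightarrow> nat \<Rightarrow> nat \<Rightarrow> (nat \<Rightarrow> nat \<Rightarrow> int) \<Rightarrow> nat \<Rightarrow> nat \<Rightarrow> int" where
  "rowop c i j a = (\<lambda>x y. if x = i then c * a j y + a x y else a x y)"

definition colop :: "int \<Rightarrow> nat \<Rightarrow> nat \<Rightarrow> (nat \<Rightarrow> nat \<Rightarrow> int) \<Rightarrow> nat \<Rightarrow> nat \<Rightarrow> int" where
  "colop c i j a = (\<lambda>x y. if y = i then c * a x j + a x y else a x y)"

inductive reach :: "nat \<Rightarrow> nat \<Rightarrow> (nat \<Rightarrow> nat \<Rightarrow> int) \<Rightarrow> (nat \<Rightarrow> nat \<Rightarrow> int) \<Rightarrow> bool" for r s a where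
  refl: "reach r s a a"
| row: "reach r s a b \<Longrightarrow> i < r \<Longrightarrow> j < r \<Longrightarrow> i \<noteq> j \<Longrightarrow> reach r s a (rowop c i j b)"
| col: "reach r s a b \<Longrightarrow> i < s \<Longrightarrow> j < s \<Longrightarrow> i \<noteq> j \<Longrightarrow> reach r s a (colop c i j b)"

lemma rowop_inverse: "i \<noteq> j \<Longrightarrow> rowop (- c) i j (rowop c i j a) = a"
  by (auto simp: rowop_def fun_eq_iff)

lemma colop_inverse: "i \<noteq> j \<Longrightarrow> colop (- c) i j (colop c i j a) = a"
  by (auto simp: colop_def fun_eq_iff)

lemma has_block_addrow:
  "has_block r s a M \<Longrightarrow> M \<in> carrier_mat n n \<Longrightarrow> i < r \<Longrightarrow> j < r \<Longrightarrow> r \<le> n \<Longrightarrow> s \<le> n \<Longrightarrow>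
    has_block r s (rowop c i j a) (addrow c i j M)"
  by (auto simp: has_block_def rowop_def)

lemma has_block_addcol:
  "has_block r s a M \<Longrightarrow> M \<in> carrier_mat n n \<Longrightarrow> i < s \<Longrightarrow> j < s \<Longrightarrow> r \<le> n \<Longrightarrow> s \<le> n \<Longrightarrow>
    has_block r s (colop c i j a) (addcol c i j M)"
  by (auto simp: has_block_def colop_def)

lemma completable_rowop:
  assumes "completable n r s a" "i < r" "j < r" "i \<noteq> j" "r \<le> n" "s \<le> n"
  shows "completable n r s (rowop c i j a)"
proof -
  obtain M where M: "M \<in> elementary n" "has_block r s a M"
    using assms(1) unfolding completable_def by blast
  have "addrow c i j M \<in> elementary n" using M assms by (intro elementary.addrow) auto
  moreover have "has_block r s (rowop c i j a) (addrow c i j M)"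
    using has_block_addrow[OF M(2) elementary_carrier[OF M(1)]] assms by blast
  ultimately show ?thesis unfolding completable_def by blast
qed

lemma completable_colop:
  assumes "completable n r s a" "i < s" "j < s" "i \<noteq> j" "r \<le> n" "s \<le> n"
  shows "completable n r s (colop c i j a)"
proof -
  obtain M where M: "M \<in> elementary n" "has_block r s a M"
    using assms(1) unfolding completable_def by blast
  have "addcol c i j M \<in> elementary n" using M assms by (intro addcol_elementary) auto
  moreover have "has_block r s (colop c i j a) (addcol c i j M)"
    using has_block_addcol[OF M(2) elementary_carrier[OF M(1)]] assms by blast
  ultimately show ?thesis unfolding completable_def by blast
qed

text \<open>The same operation on a completion of \<open>a\<close> gives a completion of the new
  block with equal determinant.\<close>

lemma completions_dvd_rowop:
  assumes "completions_dvd d n r s (rowop c i j a)" "i < r" "j < r" "i \<noteq> j" "r \<le> n" "s \<le> n"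
  shows "completions_dvd d n r s a"
  unfolding completions_dvd_def
proof (intro ballI impI)
  fix M assume M: "M \<in> carrier_mat n n" "has_block r s a M"
  have "d dvd det (addrow c i j M)"
    by (rule completions_dvdD[OF assms(1)]) (use M assms has_block_addrow in auto)
  then show "d dvd det M" using det_addrow[of j n i M c] M assms by simp
qed

lemma completions_dvd_colop:
  assumes "completions_dvd d n r s (colop c i j a)" "i < s" "j < s" "i \<noteq> j" "r \<le> n" "s \<le> n"
  shows "completions_dvd d n r s a"
  unfolding completions_dvd_def
proof (intro ballI impI)
  fix M assume M: "M \<in> carrier_mat n n" "has_block r s a M"
  have "d dvd det (addcol c i j M)"
    by (rule completions_dvdD[OF assms(1)]) (use M assms has_block_addcol in auto)
  then show "d dvd det M" using det_addcol[of j n i M c] M assms by simp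
qed

lemma completions_dvd_reach:
  assumes "reach r s a b" "completions_dvd d n r s b" "r \<le> n" "s \<le> n"
  shows "completions_dvd d n r s a"
  using assms
proof (induction rule: reach.induct)
  case (row b i j c)
  then show ?case using completions_dvd_rowop[of d n r s c i j b] by simp
next
  case (col b i j c)
  then show ?case using completions_dvd_colop[of d n r s c i j b] by simp
qed

text \<open>Completability is carried back from \<open>b\<close> to \<open>a\<close> by the inverse
  operations, with \<open>- c\<close> for \<open>c\<close>.\<close>

lemma completable_reach:
  assumes "reach r s a b" "completable n r s b" "r \<le> n" "s \<le> n"
  shows "completable n r s a"
  using assms
proof (induction rule: reach.induct)
  case (row b i j c)
  then show ?case using completable_rowop[of n r s "rowop c i j b" i j "- c"] rowop_inverse by simp
next
  case (col b i j c)
  then show ?case using completable_colop[of n r s "colop c i j b" i j "- c"] colop_inverse by simp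
qed

text \<open>Since \<open>n < r + s\<close>, the relevant minors have positive order, and expansion
  along a column brings out a factor \<open>d\<close>.\<close>

lemma completions_dvd_if_entries_dvd:
  assumes "r \<le> n" "s \<le> n" "n < r + s" "\<And>i j. i < r \<Longrightarrow> j < s \<Longrightarrow> d dvd a i j"
  shows "completions_dvd d n r s a"
proof -
  obtain k where k: "r + s = n + Suc k" using assms(3) by (metis add_Suc_right less_iff_Suc_add)
  have "minors_dvd d (Suc k) r s a"
    unfolding minors_dvd_def
  proof (intro allI impI, elim conjE)
    fix f g assume "f ` {..<Suc k} \<subseteq> {..<r}" "g ` {..<Suc k} \<subseteq> {..<s}"
    then have "f i < r" "g i < s" if "i < Suc k" for i using that by (auto simp: image_subset_iff)
    then show "d dvd minor (Suc k) a f g"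
      by (intro dvd_minor_column[of 0]) (auto intro!: dvd_mult2 assms(4))
  qed
  then show ?thesis by (rule completions_dvd_if_minors_dvd[OF assms(1,2) k])
qed

lemma reach_unit_entry:
  assumes "r \<le> n" "s \<le> n" "n < r + s" and primitive: "\<And>d. completions_dvd d n r s a \<Longrightarrow> d dvd 1"
  obtains b i j where "reach r s a b" "i < r" "j < s" "\<bar>b i j\<bar> = 1"
proof -
  define Q where "Q = (\<lambda>(b, i, j). reach r s a b \<and> i < r \<and> j < s \<and> b i j \<noteq> 0)"
  have "\<exists>x. Q x"
  proof (rule ccontr)
    assume "\<not> (\<exists>x. Q x)"
    \<comment> \<open>If \<open>a\<close> vanished on the block, every completion would be singular,
      against primitivity for \<open>d = 0\<close>.\<close>
    then have "0 dvd a i j" if "i < r" "j < s" for i j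
      using that reach.refl[of r s a] by (auto simp: Q_def)
    then have "completions_dvd 0 n r s a" by (rule completions_dvd_if_entries_dvd[OF assms(1-3)])
    then show False using primitive[of 0] by simp
  qed
  then obtain x where x: "Q x"
    and min_x: "\<And>y. Q y \<Longrightarrow> (\<lambda>(b, i, j). nat \<bar>b i j\<bar>) x \<le> (\<lambda>(b, i, j). nat \<bar>b i j\<bar>) y"
    using ex_has_least_nat[of Q _ "\<lambda>(b, i, j). nat \<bar>b i j\<bar>"] by blast
  obtain b i j where bij: "x = (b, i, j)" by (cases x)
  define m where "m = b i j"
  have b: "reach r s a b" "i < r" "j < s" "m \<noteq> 0" using x bij by (auto simp: Q_def m_def)
  have min: "\<bar>m\<bar> \<le> \<bar>b' i' j'\<bar>" if "reach r s a b'" "i' < r" "j' < s" "b' i' j' \<noteq> 0" for b' i' j'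
    using min_x[of "(b', i', j')"] that bij by (simp add: Q_def m_def)
  \<comment> \<open>The remainder modulo \<open>m\<close> is an entry of a reachable matrix and
    smaller than \<open>m\<close> in absolute value, hence 0. The matrix \<open>b'\<close> is
    arbitrary because the fact is also needed after a row operation on \<open>b\<close>.\<close>
  have row: "m dvd b' i' y" if b': "reach r s a b'" "i' < r" "j' < s" "b' i' j' = m" "y < s" for b' i' j' y
  proof (cases "y = j'")
    case False
    have "colop (- (b' i' y div m)) y j' b' i' y = b' i' y mod m"
      using b'(4) by (simp add: colop_def minus_div_mult_eq_mod[symmetric])
    then have "b' i' y mod m = 0"
      using min[of "colop (- (b' i' y div m)) y j' b'" i' y] abs_mod_less[OF b(4), of "b' i' y"] b' False
      by (force intro: reach.col)
    then show ?thesis by auto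
  qed (use that in simp)
  have col: "m dvd b' x j'" if b': "reach r s a b'" "i' < r" "j' < s" "b' i' j' = m" "x < r" for b' i' j' x
  proof (cases "x = i'")
    case False
    have "rowop (- (b' x j' div m)) x i' b' x j' = b' x j' mod m"
      using b'(4) by (simp add: rowop_def minus_div_mult_eq_mod[symmetric])
    then have "b' x j' mod m = 0"
      using min[of "rowop (- (b' x j' div m)) x i' b'" x j'] abs_mod_less[OF b(4), of "b' x j'"] b' False
      by (force intro: reach.row)
    then show ?thesis by auto
  qed (use that in simp)
  have "m dvd b x y" if xy: "x < r" "y < s" for x y
  proof (cases "x = i")
    case True
    then show ?thesis using row[OF b(1-3)] xy by (simp add: m_def)
  next
    case False
    \<comment> \<open>With this factor the entry at \<open>(x, j)\<close> becomes \<open>m\<close>,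
      so \<open>m\<close> divides the new row \<open>x\<close>; it also divides row
      \<open>i\<close>, and so the old row \<open>x\<close>.\<close>
    let ?c = "1 - b x j div m"
    have "m dvd b x j" using col[OF b(1-3)] xy by (simp add: m_def)
    then have "rowop ?c x i b x j = m" by (simp add: rowop_def m_def algebra_simps)
    then have "m dvd rowop ?c x i b x y"
      using row[of "rowop ?c x i b" x j y] b xy False by (simp add: reach.row)
    moreover have "m dvd b i y" using row[OF b(1-3)] xy by (simp add: m_def)
    ultimately show ?thesis by (simp add: rowop_def dvd_add_right_iff)
  qed
  then have "completions_dvd m n r s b" by (rule completions_dvd_if_entries_dvd[OF assms(1-3)])
  then have "m dvd 1" using primitive completions_dvd_reach[OF b(1)] assms by blast
  then show ?thesis using that[OF b(1-3)] by (simp add: m_def)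
qed

text \<open>If \<open>u\<close> is a unit then \<open>u * u = 1\<close>, and adding
  \<open>u * (1 - x)\<close> times its row or column turns a neighbouring entry \<open>x\<close>
  into 1. This replaces swaps and sign changes.\<close>

lemma reach_corner:
  assumes "reach r s a b" "i < r" "j < s" "\<bar>b i j\<bar> = 1" "1 < r"
  obtains b' where "reach r s a b'" "b' 0 0 = 1"
proof -
  have unit: "x * x = 1" if "\<bar>x\<bar> = 1" for x :: int using that by (metis abs_mult_self_eq mult_1)
  have "\<exists>b1. reach r s a b1 \<and> \<bar>b1 i 0\<bar> = 1"
  proof (cases "j = 0")
    case True
    then show ?thesis using assms by auto
  next
    case False
    let ?c = "b i j * (1 - b i 0)"
    have "colop ?c 0 j b i 0 = b i j * b i j * (1 - b i 0) + b i 0" by (simp add: colop_def)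
    then have "colop ?c 0 j b i 0 = 1" unfolding unit[OF assms(4)] by simp
    moreover have "reach r s a (colop ?c 0 j b)" using assms False by (intro reach.col) auto
    ultimately show ?thesis by fastforce
  qed
  then obtain b1 where b1: "reach r s a b1" "\<bar>b1 i 0\<bar> = 1" by blast
  \<comment> \<open>The corner may hold -1, which only another row can correct. A unit is therefore
    first placed in column 0 below the corner, using \<open>1 < r\<close>.\<close>
  have "\<exists>b2 i'. reach r s a b2 \<and> i' < r \<and> i' \<noteq> 0 \<and> \<bar>b2 i' 0\<bar> = 1"
  proof (cases "i = 0")
    case True
    let ?c = "b1 0 0 * (1 - b1 1 0)"
    have "rowop ?c 1 0 b1 1 0 = b1 0 0 * b1 0 0 * (1 - b1 1 0) + b1 1 0" by (simp add: rowop_def)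
    then have "rowop ?c 1 0 b1 1 0 = 1" using unit[OF b1(2)] True by simp
    moreover have "reach r s a (rowop ?c 1 0 b1)" using assms b1 by (intro reach.row) auto
    ultimately show ?thesis using assms(5) by (metis abs_one zero_neq_one)
  next
    case False
    then show ?thesis using assms b1 by auto
  qed
  then obtain b2 i' where b2: "reach r s a b2" "i' < r" "i' \<noteq> 0" "\<bar>b2 i' 0\<bar> = 1" by blast
  let ?c = "b2 i' 0 * (1 - b2 0 0)"
  have "rowop ?c 0 i' b2 0 0 = b2 i' 0 * b2 i' 0 * (1 - b2 0 0) + b2 0 0" by (simp add: rowop_def)
  then have "rowop ?c 0 i' b2 0 0 = 1" unfolding unit[OF b2(4)] by simp
  moreover have "reach r s a (rowop ?c 0 i' b2)" using assms b2 by (intro reach.row) auto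
  ultimately show ?thesis using that by blast
qed

lemma reach_cleared:
  assumes "reach r s a b" "b 0 0 = 1" "0 < r" "0 < s"
  obtains b' where "reach r s a b'" "b' 0 0 = 1" "\<And>i. 0 < i \<Longrightarrow> i < r \<Longrightarrow> b' i 0 = 0"
    "\<And>j. 0 < j \<Longrightarrow> j < s \<Longrightarrow> b' 0 j = 0"
proof -
  have "t \<le> r \<Longrightarrow> \<exists>b'. reach r s a b' \<and> b' 0 0 = 1 \<and> (\<forall>i. 0 < i \<and> i < t \<longrightarrow> b' i 0 = 0)" for t
  proof (induction t)
    case 0
    then show ?case using assms by auto
  next
    case (Suc t)
    then obtain b' where b': "reach r s a b'" "b' 0 0 = 1" "\<forall>i. 0 < i \<and> i < t \<longrightarrow> b' i 0 = 0"
      by auto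
    show ?case
    proof (cases "t = 0")
      case False
      have "reach r s a (rowop (- b' t 0) t 0 b')" using b' False Suc by (intro reach.row) auto
      moreover have "rowop (- b' t 0) t 0 b' 0 0 = 1"
        "\<forall>i. 0 < i \<and> i < Suc t \<longrightarrow> rowop (- b' t 0) t 0 b' i 0 = 0"
        using b' False by (auto simp: rowop_def less_Suc_eq)
      ultimately show ?thesis by blast
    qed (use b' in auto)
  qed
  then obtain b1 where b1: "reach r s a b1" "b1 0 0 = 1" "\<forall>i. 0 < i \<and> i < r \<longrightarrow> b1 i 0 = 0"
    by blast
  \<comment> \<open>Clearing row 0 changes only columns \<open>t > 0\<close>, so column 0 remains
    cleared.\<close>
  have "t \<le> s \<Longrightarrow> \<exists>b'. reach r s a b' \<and> b' 0 0 = 1 \<and> (\<forall>i. 0 < i \<and> i < r \<longrightarrow> b' i 0 = 0) \<and>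
      (\<forall>j. 0 < j \<and> j < t \<longrightarrow> b' 0 j = 0)" for t
  proof (induction t)
    case 0
    then show ?case using b1 by auto
  next
    case (Suc t)
    then obtain b' where b': "reach r s a b'" "b' 0 0 = 1" "\<forall>i. 0 < i \<and> i < r \<longrightarrow> b' i 0 = 0"
      "\<forall>j. 0 < j \<and> j < t \<longrightarrow> b' 0 j = 0"
      by auto
    show ?case
    proof (cases "t = 0")
      case False
      have "reach r s a (colop (- b' 0 t) t 0 b')" using b' False Suc by (intro reach.col) auto
      moreover have "colop (- b' 0 t) t 0 b' 0 0 = 1"
        "\<forall>i. 0 < i \<and> i < r \<longrightarrow> colop (- b' 0 t) t 0 b' i 0 = 0"
        "\<forall>j. 0 < j \<and> j < Suc t \<longrightarrow> colop (- b' 0 t) t 0 b' 0 j = 0"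
        using b' False by (auto simp: colop_def less_Suc_eq)
      ultimately show ?thesis by blast
    qed (use b' in auto)
  qed
  from this[of s] obtain b2 where "reach r s a b2" "b2 0 0 = 1"
    "\<forall>i. 0 < i \<and> i < r \<longrightarrow> b2 i 0 = 0" "\<forall>j. 0 < j \<and> j < s \<longrightarrow> b2 0 j = 0"
    by auto
  then show ?thesis by (intro that[of b2]) auto
qed

section \<open>Splitting off a corner entry 1\<close>

lemma completions_dvd_corner:
  assumes "completions_dvd d m (r - 1) (s - 1) (\<lambda>i j. b (Suc i) (Suc j))"
    and "b 0 0 = 1" "\<And>j. 0 < j \<Longrightarrow> j < s \<Longrightarrow> b 0 j = 0" "0 < r" "0 < s" "r \<le> Suc m" "s \<le> Suc m"
  shows "completions_dvd d (Suc m) r s b"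
  unfolding completions_dvd_def
proof (intro ballI impI)
  fix M assume M: "M \<in> carrier_mat (Suc m) (Suc m)" "has_block r s b M"
  \<comment> \<open>Right multiplication by \<open>T\<close> subtracts multiples of column 0 from
    the columns outside the block, so that row 0 becomes a unit vector while the block stays the
    same.\<close>
  define T where "T = transvection (Suc m) ({0} \<times> {s..<Suc m}) (\<lambda>i j. - M $$ (0, j))"
  have T: "T \<in> elementary (Suc m)"
    unfolding T_def by (rule transvection_elementary) (use assms in auto)
  note T' = elementary_carrier[OF T]
  define N where "N = M * T"
  have N: "N \<in> carrier_mat (Suc m) (Suc m)" unfolding N_def using M T' by simp
  have entry: "N $$ (x, y) = M $$ (x, y) - (if s \<le> y then M $$ (x, 0) * M $$ (0, y) else 0)"
    if "x < Suc m" "y < Suc m" for x y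
  proof -
    have "N $$ (x, y) = (\<Sum>q = 0..<Suc m. M $$ (x, q) * T $$ (q, y))"
      using M T' that by (simp add: N_def scalar_prod_def)
    also have "\<dots> = (\<Sum>q = 0..<Suc m. (if q = y then M $$ (x, q) else 0) -
        (if q = 0 then (if s \<le> y then M $$ (x, 0) * M $$ (0, y) else 0) else 0))"
      by (rule sum.cong) (use that in \<open>auto simp: T_def transvection_def algebra_simps\<close>)
    also have "\<dots> = M $$ (x, y) - (if s \<le> y then M $$ (x, 0) * M $$ (0, y) else 0)"
      using that by (simp add: sum_subtractf del: sum.op_ivl_Suc)
    finally show ?thesis .
  qed
  have "M $$ (0, 0) = 1" using M assms by (simp add: has_block_def)
  moreover have "M $$ (0, y) = 0" if "0 < y" "y < s" for y
    using M assms that by (simp add: has_block_def)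
  ultimately have row0: "N $$ (0, y) = (if y = 0 then 1 else 0)" if "y < Suc m" for y
    using entry[of 0 y] that assms(5) by auto
  have "det N = (\<Sum>j<Suc m. N $$ (0, j) * cofactor N 0 j)"
    by (rule laplace_expansion_row[OF N]) simp
  also have "\<dots> = (\<Sum>j<Suc m. if j = 0 then cofactor N 0 j else 0)"
    by (rule sum.cong) (simp_all add: row0)
  also have "\<dots> = det (mat_delete N 0 0)"
    by (simp add: cofactor_def del: sum.lessThan_Suc)
  finally have "det N = det (mat_delete N 0 0)" .
  moreover have "det N = det M" unfolding N_def using det_mult[OF M(1) T'] det_elementary[OF T] by simp
  moreover have "d dvd det (mat_delete N 0 0)"
  proof (rule completions_dvdD[OF assms(1)])
    show "mat_delete N 0 0 \<in> carrier_mat m m" using mat_delete_carrier[OF N] by simp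
    show "has_block (r - 1) (s - 1) (\<lambda>i j. b (Suc i) (Suc j)) (mat_delete N 0 0)"
      using N M(2) assms by (auto simp: has_block_def mat_delete_def entry)
  qed
  ultimately show "d dvd det M" by simp
qed

text \<open>The block diagonal matrix with blocks 1 and \<open>M\<close>.\<close>

definition unit_extend :: "nat \<Rightarrow> int mat \<Rightarrow> int mat" where
  "unit_extend m M = mat (Suc m) (Suc m) (\<lambda>(i, j). if i = 0 \<and> j = 0 then 1
     else if i = 0 \<or> j = 0 then 0 else M $$ (i - 1, j - 1))"

lemma unit_extend_elementary: "M \<in> elementary m \<Longrightarrow> unit_extend m M \<in> elementary (Suc m)"
proof (induction rule: elementary.induct)
  case one
  have "unit_extend m (1\<^sub>m m) = 1\<^sub>m (Suc m)" by (rule eq_matI) (auto simp: unit_extend_def)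
  then show ?case by (simp add: elementary.one)
next
  case (addrow M i j c)
  have "unit_extend m (addrow c i j M) = addrow c (Suc i) (Suc j) (unit_extend m M)"
    by (rule eq_matI) (use elementary_carrier[OF addrow.hyps(1)] addrow.hyps in \<open>auto simp: unit_extend_def\<close>)
  then show ?case using addrow by (simp add: elementary.addrow)
qed

lemma completable_corner:
  assumes "completable m (r - 1) (s - 1) (\<lambda>i j. b (Suc i) (Suc j))"
    and "b 0 0 = 1" "\<And>i. 0 < i \<Longrightarrow> i < r \<Longrightarrow> b i 0 = 0" "\<And>j. 0 < j \<Longrightarrow> j < s \<Longrightarrow> b 0 j = 0"
    and "r \<le> Suc m" "s \<le> Suc m"
  shows "completable (Suc m) r s b"
proof -
  obtain M where M: "M \<in> elementary m" "has_block (r - 1) (s - 1) (\<lambda>i j. b (Suc i) (Suc j)) M"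
    using assms(1) unfolding completable_def by blast
  have "has_block r s b (unit_extend m M)"
    unfolding has_block_def
  proof (intro allI impI)
    fix i j assume "i < r" "j < s"
    then show "unit_extend m M $$ (i, j) = b i j"
      using assms M(2) by (cases i; cases j) (auto simp: unit_extend_def has_block_def)
  qed
  then show ?thesis unfolding completable_def using unit_extend_elementary[OF M(1)] by blast
qed

text \<open>Induction on \<open>n\<close>. Divisors for the smaller block are divisors for the
  corner form, hence for \<open>a\<close>, so primitivity is inherited; a completion travels back
  the same way. Lowering \<open>n\<close>, \<open>r\<close>, \<open>s\<close> together preserves
  \<open>s \<le> r\<close> and \<open>s < n\<close>.\<close>

lemma completable_if_primitive:
  assumes "r \<le> n" "s \<le> r" "s < n" "n < r + s \<Longrightarrow> \<forall>d. completions_dvd d n r s a \<longrightarrow> d dvd 1"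
  shows "completable n r s a"
  using assms
proof (induction n arbitrary: r s a)
  case (Suc m)
  show ?case
  proof (cases "r + s \<le> Suc m")
    case True
    then show ?thesis using Suc.prems completable_if_le by blast
  next
    case False
    then have rs: "r \<le> Suc m" "s \<le> Suc m" "Suc m < r + s" "1 < r" "0 < s" using Suc.prems by auto
    have primitive: "d dvd 1" if "completions_dvd d (Suc m) r s a" for d
      using Suc.prems(4) rs that by blast
    obtain b0 i j where "reach r s a b0" "i < r" "j < s" "\<bar>b0 i j\<bar> = 1"
      using reach_unit_entry[OF rs(1-3) primitive] by blast
    then obtain b1 where "reach r s a b1" "b1 0 0 = 1" using reach_corner rs(4) by blast
    then obtain b where b: "reach r s a b" "b 0 0 = 1" "\<And>i. 0 < i \<Longrightarrow> i < r \<Longrightarrow> b i 0 = 0"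
      "\<And>j. 0 < j \<Longrightarrow> j < s \<Longrightarrow> b 0 j = 0"
      using reach_cleared rs by (metis gr0I not_one_less_zero)
    have "completable m (r - 1) (s - 1) (\<lambda>i j. b (Suc i) (Suc j))"
    proof (rule Suc.IH)
      show "\<forall>d. completions_dvd d m (r - 1) (s - 1) (\<lambda>i j. b (Suc i) (Suc j)) \<longrightarrow> d dvd 1"
      proof (intro allI impI)
        fix d assume "completions_dvd d m (r - 1) (s - 1) (\<lambda>i j. b (Suc i) (Suc j))"
        then have "completions_dvd d (Suc m) r s b"
          by (rule completions_dvd_corner) (use b rs in auto)
        then show "d dvd 1" using primitive completions_dvd_reach[OF b(1)] rs by blast
      qed
    qed (use Suc.prems rs in auto)
    then have "completable (Suc m) r s b" by (rule completable_corner) (use b rs in auto)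
    then show ?thesis using completable_reach[OF b(1)] rs by blast
  qed
qed simp

section \<open>Minors as determinants of submatrices, and the conclusion\<close>

lemma pick_image_strict_mono:
  assumes "strict_mono_on {..<k} f" "i < k"
  shows "pick (f ` {..<k}) i = f i"
proof -
  \<comment> \<open>Exactly \<open>i\<close> elements of the image are smaller than
    \<open>f i\<close>, which identifies it as the pick number \<open>i\<close>.\<close>
  have lt: "f x < f i \<longleftrightarrow> x < i" if "x < k" for x
    using assms that by (auto simp: strict_mono_on_less)
  have "{y \<in> f ` {..<k}. y < f i} = f ` {..<i}" using lt assms(2) by auto
  moreover have "inj_on f {..<i}"
    using strict_mono_on_imp_inj_on[OF assms(1)] assms(2) by (auto intro: inj_on_subset)
  ultimately have "card {y \<in> f ` {..<k}. y < f i} = i" by (simp add: card_image)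
  then show ?thesis using pick_card_in_set[of "f i" "f ` {..<k}"] assms(2) by auto
qed

lemma det_submatrix_eq_minor:
  assumes "A \<in> carrier_mat r s" "I \<subseteq> {0..<r}" "J \<subseteq> {0..<s}" "card I = k" "card J = k"
  shows "det (submatrix A I J) = minor k (\<lambda>i j. A $$ (i, j)) (pick I) (pick J)"
proof -
  have "{i. i < r \<and> i \<in> I} = I" "{j. j < s \<and> j \<in> J} = J" using assms by auto
  then show ?thesis using assms by (simp add: submatrix_def minor_def)
qed

lemma minors_dvd_iff:
  assumes A: "A \<in> carrier_mat r s"
  shows "minors_dvd d k r s (\<lambda>i j. A $$ (i, j)) \<longleftrightarrow> (\<forall>x\<in>minors k A. d dvd x)"
proof (intro iffI ballI)
  fix x assume *: "minors_dvd d k r s (\<lambda>i j. A $$ (i, j))" and "x \<in> minors k A"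
  then obtain I J where IJ: "x = det (submatrix A I J)" "I \<subseteq> {0..<r}" "J \<subseteq> {0..<s}" "card I = k" "card J = k"
    using A by (auto simp: minors_def)
  have "strict_mono_on {..<k} (pick K) \<and> pick K ` {..<k} \<subseteq> {..<t}" if "K \<subseteq> {0..<t}" "card K = k" for K t
    using that pick_mono_le[of _ K] pick_in_set_le[of _ K] by (fastforce simp: strict_mono_on_def)
  then show "d dvd x"
    using * IJ det_submatrix_eq_minor[OF A IJ(2-5)] by (simp add: minors_dvd_def)
next
  assume *: "\<forall>x\<in>minors k A. d dvd x"
  show "minors_dvd d k r s (\<lambda>i j. A $$ (i, j))"
    unfolding minors_dvd_def
  proof (intro allI impI, elim conjE)
    fix f g assume fg: "strict_mono_on {..<k} f" "strict_mono_on {..<k} g"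
      "f ` {..<k} \<subseteq> {..<r}" "g ` {..<k} \<subseteq> {..<s}"
    have card: "card (f ` {..<k}) = k" "card (g ` {..<k}) = k"
      using fg by (simp_all add: card_image strict_mono_on_imp_inj_on)
    have sub: "f ` {..<k} \<subseteq> {0..<r}" "g ` {..<k} \<subseteq> {0..<s}" using fg by auto
    have "det (submatrix A (f ` {..<k}) (g ` {..<k})) = minor k (\<lambda>i j. A $$ (i, j)) f g"
      unfolding det_submatrix_eq_minor[OF A sub card]
      by (rule minor_cong) (simp add: pick_image_strict_mono fg)
    moreover have "det (submatrix A (f ` {..<k}) (g ` {..<k})) \<in> minors k A"
      using A sub card by (auto simp: minors_def)
    ultimately show "d dvd minor k (\<lambda>i j. A $$ (i, j)) f g" using * by force
  qed
qed

lemma Gcd_eq_one_iff: "(\<forall>d::int. (\<forall>x\<in>S. d dvd x) \<longrightarrow> d dvd 1) \<longleftrightarrow> Gcd S = 1"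
proof
  assume "\<forall>d::int. (\<forall>x\<in>S. d dvd x) \<longrightarrow> d dvd 1"
  then have "Gcd S dvd 1" by (metis Gcd_dvd)
  then show "Gcd S = 1" by (metis is_unit_normalize normalize_Gcd)
next
  assume "Gcd S = 1"
  then show "\<forall>d::int. (\<forall>x\<in>S. d dvd x) \<longrightarrow> d dvd 1" by (metis Gcd_greatest)
qed

lemma bordered_mat_carrier: "bordered_mat n A X Y \<in> carrier_mat n n"
  by (simp add: bordered_mat_def Let_def)

theorem theorem5:
  shows "(\<forall>(n::nat) (r::nat) (s::nat) (A::int mat).
            1 \<le> s \<and> s \<le> r \<and> r \<le> n \<and> s < n \<and> A \<in> carrier_mat r s \<longrightarrow>
            ((\<forall>b::int. \<exists>X \<in> carrier_mat (n - r) s. \<exists>Y \<in> carrier_mat n (n - s).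
                bordered_det n A X Y = b)
             \<longleftrightarrow> (r + s \<le> n \<or> (r + s > n \<and> Gcd (minors (r + s - n) A) = 1))))
       \<and> (\<exists>alg. \<forall>(n::nat) (r::nat) (s::nat) (A::int mat).
            1 \<le> s \<and> s \<le> r \<and> r \<le> n \<and> s < n \<and> A \<in> carrier_mat r s \<and>
            (r + s \<le> n \<or> (r + s > n \<and> Gcd (minors (r + s - n) A) = 1)) \<longrightarrow>
            (\<exists>X Y. recf_eval alg [n, r, s, mat_encode int_encode A]
                     (prod_encode (mat_encode poly_encode X, mat_encode poly_encode Y))
                 \<and> parametric_solution n A X Y))"
proof -
  \<comment> \<open>By \<open>n \<le> r + s\<close> the subtraction \<open>r + s - n\<close> is not
    truncated.\<close>
  have minors: "completions_dvd d n r s (\<lambda>i j. A $$ (i, j)) \<longleftrightarrow> (\<forall>x\<in>minors (r + s - n) A. d dvd x)"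
    if "r \<le> n" "s \<le> n" "n \<le> r + s" "A \<in> carrier_mat r s" for d n r s A
    using that completions_dvd_if_minors_dvd[of r n s "r + s - n" d "\<lambda>i j. A $$ (i, j)"]
      completions_dvd_imp_minors_dvd[of r n s "r + s - n" d "\<lambda>i j. A $$ (i, j)"]
      minors_dvd_iff[OF that(4)] by auto
  have completion: "\<exists>M\<in>elementary n. \<forall>i<r. \<forall>j<s. M $$ (i, j) = A $$ (i, j)"
    if "s \<le> r" "r \<le> n" "s < n" "A \<in> carrier_mat r s"
      "r + s \<le> n \<or> (r + s > n \<and> Gcd (minors (r + s - n) A) = 1)" for n r s A
    using that completable_if_primitive[of r n s "\<lambda>i j. A $$ (i, j)"] minors[of r n s A]
      Gcd_eq_one_iff[of "minors (r + s - n) A"]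
    by (auto simp: completable_def has_block_def)
  obtain alg where alg: "\<And>n r s A. A \<in> carrier_mat r s \<Longrightarrow> r \<le> n \<Longrightarrow> s < n \<Longrightarrow>
      \<exists>M\<in>elementary n. \<forall>i<r. \<forall>j<s. M $$ (i, j) = A $$ (i, j) \<Longrightarrow>
      \<exists>X Y. recf_eval alg [n, r, s, mat_encode int_encode A]
        (prod_encode (mat_encode poly_encode X, mat_encode poly_encode Y)) \<and> parametric_solution n A X Y"
    using exists_algorithm by metis
  \<comment> \<open>Necessity rests on the single value 1: a common divisor of the minors divides
    every value of the determinant.\<close>
  have gcd: "Gcd (minors (r + s - n) A) = 1"
    if "r \<le> n" "s < n" "n < r + s" and A: "A \<in> carrier_mat r s"
      and X: "bordered_det n A X Y = 1" for n r s A X Y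
  proof -
    have "has_block r s (\<lambda>i j. A $$ (i, j)) (bordered_mat n A X Y)"
      using that by (auto simp: has_block_def bordered_mat_def Let_def)
    then have "d dvd bordered_det n A X Y" if "completions_dvd d n r s (\<lambda>i j. A $$ (i, j))" for d
      unfolding bordered_det_def by (rule completions_dvdD[OF that bordered_mat_carrier])
    then have "d dvd 1" if "completions_dvd d n r s (\<lambda>i j. A $$ (i, j))" for d
      using that X by metis
    then show ?thesis using minors[of r n s A] that by (simp add: Gcd_eq_one_iff[symmetric])
  qed
  \<comment> \<open>Sufficiency comes from the algorithm: its output is evaluated at
    \<open>b\<close>.\<close>
  have all: "\<exists>X\<in>carrier_mat (n - r) s. \<exists>Y\<in>carrier_mat n (n - s). bordered_det n A X Y = b"
    if A: "s \<le> r" "r \<le> n" "s < n" "A \<in> carrier_mat r s"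
      "r + s \<le> n \<or> (r + s > n \<and> Gcd (minors (r + s - n) A) = 1)" for n r s A b
  proof -
    obtain X Y where XY: "parametric_solution n A X Y"
      using alg[OF A(4,2,3) completion[OF A]] by blast
    show ?thesis
      by (rule bexI[of _ "map_mat (\<lambda>p. poly p b) X"], rule bexI[of _ "map_mat (\<lambda>p. poly p b) Y"])
        (use XY A(4) in \<open>auto simp: parametric_solution_def\<close>)
  qed
  show ?thesis
  proof (intro conjI exI[of _ alg] allI impI iffI)
    fix n r s and A :: "int mat"
    assume A: "1 \<le> s \<and> s \<le> r \<and> r \<le> n \<and> s < n \<and> A \<in> carrier_mat r s"
      and "\<forall>b. \<exists>X\<in>carrier_mat (n - r) s. \<exists>Y\<in>carrier_mat n (n - s). bordered_det n A X Y = b"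
    then obtain X Y where "bordered_det n A X Y = 1" by blast
    then show "r + s \<le> n \<or> (r + s > n \<and> Gcd (minors (r + s - n) A) = 1)"
      using gcd[of r n s A X Y] A by linarith
  next
    fix n r s b and A :: "int mat"
    assume "1 \<le> s \<and> s \<le> r \<and> r \<le> n \<and> s < n \<and> A \<in> carrier_mat r s"
      and "r + s \<le> n \<or> (r + s > n \<and> Gcd (minors (r + s - n) A) = 1)"
    then show "\<exists>X\<in>carrier_mat (n - r) s. \<exists>Y\<in>carrier_mat n (n - s). bordered_det n A X Y = b"
      using all by simp
  next
    fix n r s and A :: "int mat"
    assume "1 \<le> s \<and> s \<le> r \<and> r \<le> n \<and> s < n \<and> A \<in> carrier_mat r s \<and>
      (r + s \<le> n \<or> (r + s > n \<and> Gcd (minors (r + s - n) A) = 1))"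
    then show "\<exists>X Y. recf_eval alg [n, r, s, mat_encode int_encode A]
        (prod_encode (mat_encode poly_encode X, mat_encode poly_encode Y)) \<and> parametric_solution n A X Y"
      using alg completion by simp
  qed
qed

end
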